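(* Let $G$ be a finitely generated discrete group, let $S$ be a finite symmetric generating set of $G$, and let $P$ be the step distribution of the lazy simple random walk on the Cayley graph of $(G,S)$. Suppose there are constants $L,K>0$ and $\gamma\ge 0$ such that $P^{(n)}(e)\geq L e^{-Kn^{\gamma}}$ for all $n\ge 1$. Then the equivariant (Hilbertian) compression exponent of $G$ satisfies $$\alpha(G)\ \geq\ \frac{1-\gamma}{1+\gamma}.$$
   Context: For a finite symmetric generating set $S$ of $G$, $P=\tfrac12(\delta_e+P')$ where $P'=\mathbf 1_S/|S|$ is the uniform distribution on $S$; $P^{(n)}$ is the $n$-fold convolution of $P$ with itself. $|g|$ denotes the word length of $g\in G$ with respect to $S$, and $e$ is the identity. Compression exponent: let $B$ be a Hilbert space and $\pi:G\to\mathrm{Isom}(B)$ a homomorphism to the group of (affine) isometries of $B$. An equivariant uniform embedding is a map $f:G\to B$ with $f(\gamma x)=\pi(\gamma)f(x)$ for all $\gamma,x\in G$, for which there exist an unbounded increasing (non-decreasing) function $\rho_-:\mathbb R_{\ge0}\to\mathbb R_{\ge0}$ and a constant $C>0$ with $$\rho_-(|y^{-1}x|)\le\|f(x)-f(y)\|\le C|y^{-1}x|+C\qquad\text{for all }x,y\in G.$$ Such a $\rho_-$ is called a compression function of $f$. The compression exponent $\alpha(f)$ is the supremum of the $c\in[0,1]$ for which there exist $K>0$ and a compression function $\rho_-$ of $f$ with $\rho_-(n)\ge Kn^c$ for all integers $n\ge1$. The equivariant compression exponent $\alpha(G)$ is the supremum of $\alpha(f)$ over all Hilbert spaces $B$,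 all $\pi$ and all equivariant uniform embeddings $f$ (with $\alpha(G)=0$ if there are none). It does not depend on the choice of $S$. *)

theory Defs
  imports "HOL-Analysis.Analysis" "HOL-Algebra.Module" "HOL-Algebra.Bij"
    "HOL-Algebra.Generated_Groups"
begin

section \<open>Word length and the lazy random walk\<close>

definition finite_symmetric_generating_set :: "('g, 'm) monoid_scheme \<Rightarrow> 'g set \<Rightarrow> bool" where
  "finite_symmetric_generating_set G S \<longleftrightarrow>
     finite S \<and> S \<subseteq> carrier G \<and> (\<forall>s\<in>S. inv\<^bsub>G\<^esub> s \<in> S) \<and> generate G S = carrier G"

text \<open>The generating sets are symmetric, so no inverses are needed in the words.\<close>

definition word_length :: "('g, 'm) monoid_scheme \<Rightarrow> 'g set \<Rightarrow> 'g \<Rightarrow> nat" where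
  "word_length G S g =
     (LEAST n. \<exists>ws. length ws = n \<and> set ws \<subseteq> S \<and> foldr (mult G) ws \<one>\<^bsub>G\<^esub> = g)"

definition lazy_step :: "('g, 'm) monoid_scheme \<Rightarrow> 'g set \<Rightarrow> 'g \<Rightarrow> real" where
  "lazy_step G S g = (indicator {\<one>\<^bsub>G\<^esub>} g + indicator S g / real (card S)) / 2"

definition convolution ::
  "('g, 'm) monoid_scheme \<Rightarrow> ('g \<Rightarrow> real) \<Rightarrow> ('g \<Rightarrow> real) \<Rightarrow> 'g \<Rightarrow> real" where
  "convolution G \<mu> \<nu> g = (\<Sum>\<^sub>\<infinity>h\<in>carrier G. \<mu> h * \<nu> (inv\<^bsub>G\<^esub> h \<otimes>\<^bsub>G\<^esub> g))"

primrec convolution_power ::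
  "('g, 'm) monoid_scheme \<Rightarrow> ('g \<Rightarrow> real) \<Rightarrow> nat \<Rightarrow> 'g \<Rightarrow> real" where
  "convolution_power G \<mu> 0 = indicator {\<one>\<^bsub>G\<^esub>}"
| "convolution_power G \<mu> (Suc n) = convolution G \<mu> (convolution_power G \<mu> n)"


section \<open>Hilbert spaces with explicit carrier and their isometries\<close>

text \<open>
  The compression exponent is a supremum over all Hilbert spaces, hence Hilbert spaces have to
  be objects of the logic and not merely types of a class.  The scalars are real: passing to the
  underlying real space, or to the complexification, loses no embeddings and no distances.
\<close>

definition real_ring :: "real ring" where
  "real_ring = \<lparr>carrier = UNIV, mult = (*), one = 1, zero = 0, add = (+)\<rparr>"

text \<open>
  As for every module of HOL-Algebra, the fields for multiplication and one of the underlying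
  ring record carry no meaning.
\<close>

record 'u inner_space = "(real, 'u) module" +
  ip :: "'u \<Rightarrow> 'u \<Rightarrow> real"

definition ip_dist :: "('u, 'm) inner_space_scheme \<Rightarrow> 'u \<Rightarrow> 'u \<Rightarrow> real" where
  "ip_dist H x y = sqrt (ip H (x \<ominus>\<^bsub>H\<^esub> y) (x \<ominus>\<^bsub>H\<^esub> y))"

locale pre_hilbert_space = Module.module real_ring H for H (structure) +
  assumes ip_commute: "\<lbrakk>x \<in> carrier H; y \<in> carrier H\<rbrakk> \<Longrightarrow> ip H x y = ip H y x"
    and ip_add_left: "\<lbrakk>x \<in> carrier H; y \<in> carrier H; z \<in> carrier H\<rbrakk> \<Longrightarrow>
      ip H (x \<oplus> y) z = ip H x z + ip H y z"
    and ip_smult_left: "\<lbrakk>x \<in> carrier H; y \<in> carrier H\<rbrakk> \<Longrightarrow> ip H (r \<odot>\<^bsub>H\<^esub> x) y = r * ip H x y"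
    and ip_nonneg: "x \<in> carrier H \<Longrightarrow> 0 \<le> ip H x x"
    and ip_definite: "\<lbrakk>x \<in> carrier H; ip H x x = 0\<rbrakk> \<Longrightarrow> x = \<zero>"

locale hilbert_space = pre_hilbert_space +
  assumes complete:
    "\<lbrakk>range \<sigma> \<subseteq> carrier H; \<forall>\<epsilon>>0. \<exists>N. \<forall>m\<ge>N. \<forall>n\<ge>N. ip_dist H (\<sigma> m) (\<sigma> n) < \<epsilon>\<rbrakk> \<Longrightarrow>
      \<exists>l\<in>carrier H. (\<lambda>n. ip_dist H (\<sigma> n) l) \<longlonglongrightarrow> 0"

text \<open>
  By the Mazur--Ulam theorem the affinity clause is automatic for surjective isometries.
\<close>

definition affine_isometry ::
  "('u, 'm) inner_space_scheme \<Rightarrow> ('u \<Rightarrow> 'u) \<Rightarrow> bool" where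
  "affine_isometry H T \<longleftrightarrow>
     (\<forall>x\<in>carrier H. \<forall>y\<in>carrier H. ip_dist H (T x) (T y) = ip_dist H x y) \<and>
     (\<forall>x\<in>carrier H. \<forall>y\<in>carrier H. \<forall>t.
        T ((1 - t) \<odot>\<^bsub>H\<^esub> x \<oplus>\<^bsub>H\<^esub> t \<odot>\<^bsub>H\<^esub> y) = (1 - t) \<odot>\<^bsub>H\<^esub> T x \<oplus>\<^bsub>H\<^esub> t \<odot>\<^bsub>H\<^esub> T y)"

definition Isom :: "('u, 'm) inner_space_scheme \<Rightarrow> ('u \<Rightarrow> 'u) monoid" where
  "Isom H = BijGroup (carrier H) \<lparr>carrier := {T \<in> Bij (carrier H). affine_isometry H T}\<rparr>"


section \<open>Equivariant uniform embeddings and compression\<close>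

definition compression_function ::
  "('g, 'm) monoid_scheme \<Rightarrow> 'g set \<Rightarrow> ('u, 'n) inner_space_scheme \<Rightarrow> ('g \<Rightarrow> 'u) \<Rightarrow>
   (real \<Rightarrow> real) \<Rightarrow> bool" where
  "compression_function G S H f \<rho> \<longleftrightarrow>
     (\<forall>t\<ge>0. 0 \<le> \<rho> t) \<and> mono_on {0..} \<rho> \<and> \<not> bdd_above (\<rho> ` {0..}) \<and>
     (\<forall>x\<in>carrier G. \<forall>y\<in>carrier G.
        \<rho> (real (word_length G S (inv\<^bsub>G\<^esub> y \<otimes>\<^bsub>G\<^esub> x))) \<le> ip_dist H (f x) (f y))"

definition equivariant_uniform_embedding ::
  "('g, 'm) monoid_scheme \<Rightarrow> 'g set \<Rightarrow> ('u, 'n) inner_space_scheme \<Rightarrow> ('g \<Rightarrow> 'u) \<Rightarrow> bool" where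
  "equivariant_uniform_embedding G S H f \<longleftrightarrow>
     f \<in> carrier G \<rightarrow> carrier H \<and>
     (\<exists>\<pi>\<in>hom G (Isom H). \<forall>g\<in>carrier G. \<forall>x\<in>carrier G. f (g \<otimes>\<^bsub>G\<^esub> x) = \<pi> g (f x)) \<and>
     (\<exists>\<rho>. compression_function G S H f \<rho>) \<and>
     (\<exists>C>0. \<forall>x\<in>carrier G. \<forall>y\<in>carrier G.
        ip_dist H (f x) (f y) \<le> C * real (word_length G S (inv\<^bsub>G\<^esub> y \<otimes>\<^bsub>G\<^esub> x)) + C)"

text \<open>
  Both suprema below are taken in the interval from 0 to 1, so that the empty supremum is 0;
  this is the purpose of inserting 0.  For a non-injective \<open>f\<close> the set in the first
  definition is indeed empty.
\<close>

definition compression_exponent ::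
  "('g, 'm) monoid_scheme \<Rightarrow> 'g set \<Rightarrow> ('u, 'n) inner_space_scheme \<Rightarrow> ('g \<Rightarrow> 'u) \<Rightarrow> real" where
  "compression_exponent G S H f =
     Sup (insert 0 {c \<in> {0..1}. \<exists>K>0. \<exists>\<rho>. compression_function G S H f \<rho> \<and>
       (\<forall>n::nat. n \<ge> 1 \<longrightarrow> \<rho> (real n) \<ge> K * real n powr c)})"

text \<open>
  HOL cannot quantify over types inside a term, so the Hilbert spaces here have their carriers
  in the type \<open>'g \<Rightarrow> real\<close>.  Nothing is lost: by
  \<open>compression_exponent_le_equivariant\<close> below, the exponent of an equivariant uniform
  embedding into a Hilbert space over any type whatsoever is bounded by this supremum.
\<close>

definition equivariant_compression_exponent ::
  "('g, 'm) monoid_scheme \<Rightarrow> 'g set \<Rightarrow> real" where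
  "equivariant_compression_exponent G S =
     Sup (insert 0 {compression_exponent G S H f | (H :: ('g \<Rightarrow> real) inner_space) f.
       hilbert_space H \<and> equivariant_uniform_embedding G S H f})"


section \<open>Embeddings into Hilbert spaces over arbitrary types\<close>

text \<open>
  Any embedding \<open>f\<close> may be translated by \<open>- f(e)\<close> and cut down to the closed linear span \<open>V\<close>
  of the translated orbit; the map sending \<open>v \<in> V\<close> to its inner products with the points of that
  orbit is an injection of \<open>V\<close> into \<open>'g \<Rightarrow> real\<close>, along which the structure is transported.
\<close>

lemma real_ring_simps [simp]:
  "carrier real_ring = UNIV" "mult real_ring = (*)" "one real_ring = 1"
  "zero real_ring = 0" "add real_ring = (+)"
  by (simp_all add: real_ring_def)

lemma cring_real_ring: "cring real_ring"
proof (rule cringI)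
  show "abelian_group real_ring"
    by (rule abelian_groupI) (simp_all, metis add.left_inverse)
  show "comm_monoid real_ring"
    by (rule comm_monoidI) auto
qed (simp add: distrib_right)

context pre_hilbert_space
begin

lemma smult_in [simp]: "x \<in> carrier H \<Longrightarrow> r \<odot>\<^bsub>H\<^esub> x \<in> carrier H"
  by (rule smult_closed) simp_all

lemma ip_zero_left [simp]: "x \<in> carrier H \<Longrightarrow> ip H \<zero> x = 0"
  using ip_add_left[of \<zero> \<zero> x] by simp

lemma ip_zero_right [simp]: "x \<in> carrier H \<Longrightarrow> ip H x \<zero> = 0"
  by (simp add: ip_commute[of x \<zero>])

lemma ip_minus_left: "\<lbrakk>x \<in> carrier H; y \<in> carrier H\<rbrakk> \<Longrightarrow> ip H (\<ominus> x) y = - ip H x y"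
  using ip_add_left[of x "\<ominus> x" y] by (simp add: M.r_neg)

lemma ip_diff_left:
  "\<lbrakk>x \<in> carrier H; y \<in> carrier H; z \<in> carrier H\<rbrakk> \<Longrightarrow> ip H (x \<ominus> y) z = ip H x z - ip H y z"
  by (simp add: a_minus_def ip_add_left ip_minus_left)

lemma ip_add_right:
  "\<lbrakk>x \<in> carrier H; y \<in> carrier H; z \<in> carrier H\<rbrakk> \<Longrightarrow> ip H z (x \<oplus> y) = ip H z x + ip H z y"
  by (simp add: ip_commute[of z] ip_add_left)

lemma ip_smult_right:
  "\<lbrakk>x \<in> carrier H; y \<in> carrier H\<rbrakk> \<Longrightarrow> ip H x (r \<odot>\<^bsub>H\<^esub> y) = r * ip H x y"
  by (simp add: ip_commute[of x] ip_smult_left)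

lemma ip_diff_right:
  "\<lbrakk>x \<in> carrier H; y \<in> carrier H; z \<in> carrier H\<rbrakk> \<Longrightarrow> ip H z (x \<ominus> y) = ip H z x - ip H z y"
  by (simp add: ip_commute[of z] ip_diff_left)

lemmas ip_left = ip_add_left ip_smult_left ip_diff_left
lemmas ip_right = ip_add_right ip_smult_right ip_diff_right

lemma eq_of_diff_eq_zero:
  assumes "x \<in> carrier H" "y \<in> carrier H" and "x \<ominus> y = \<zero>"
  shows "x = y"
proof -
  have "(x \<ominus> y) \<oplus> y = \<zero> \<oplus> y" using assms by simp
  then show ?thesis
    using assms(1,2) by (simp add: a_minus_def M.a_assoc M.l_neg)
qed

lemma vector_eqI:
  assumes "x \<in> carrier H" "y \<in> carrier H"
    and "\<And>z. z \<in> carrier H \<Longrightarrow> ip H x z = ip H y z"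
  shows "x = y"
proof -
  have "x \<ominus> y = \<zero>"
    using assms by (intro ip_definite) (simp_all add: ip_diff_left)
  with assms(1,2) show ?thesis by (rule eq_of_diff_eq_zero)
qed

lemma Cauchy_Schwarz:
  assumes [simp]: "x \<in> carrier H" "y \<in> carrier H"
  shows "\<bar>ip H x y\<bar> \<le> sqrt (ip H x x) * sqrt (ip H y y)"
proof (cases "ip H y y = 0")
  case True
  then have "y = \<zero>" by (intro ip_definite) simp_all
  then show ?thesis by simp
next
  case False
  then have pos: "ip H y y > 0" using ip_nonneg[of y] by simp
  define r where "r = ip H x y / ip H y y"
  have "0 \<le> ip H (x \<ominus> r \<odot>\<^bsub>H\<^esub> y) (x \<ominus> r \<odot>\<^bsub>H\<^esub> y)"
    by (simp add: ip_nonneg)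
  also have "\<dots> = ip H x x - 2 * r * ip H x y + r * r * ip H y y"
    by (simp add: ip_left ip_right ip_commute[of y x] algebra_simps)
  also have "\<dots> = ip H x x - (ip H x y)\<^sup>2 / ip H y y"
    using pos by (simp add: r_def field_simps power2_eq_square)
  finally have "(ip H x y)\<^sup>2 \<le> ip H x x * ip H y y"
    using pos by (simp add: field_simps)
  then have "sqrt ((ip H x y)\<^sup>2) \<le> sqrt (ip H x x * ip H y y)"
    by (rule real_sqrt_le_mono)
  then show ?thesis by (simp add: real_sqrt_mult)
qed

lemma ip_dist_expand:
  "\<lbrakk>x \<in> carrier H; y \<in> carrier H\<rbrakk> \<Longrightarrow> ip_dist H x y = sqrt (ip H x x - 2 * ip H x y + ip H y y)"
  by (simp add: ip_dist_def ip_left ip_right ip_commute[of y x])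

lemma ip_dist_translate:
  assumes [simp]: "x \<in> carrier H" "y \<in> carrier H" "c \<in> carrier H"
  shows "ip_dist H (x \<ominus> c) (y \<ominus> c) = ip_dist H x y"
proof -
  have "(x \<ominus> c) \<ominus> (y \<ominus> c) = x \<ominus> y"
    by (rule vector_eqI) (simp_all add: ip_left)
  then show ?thesis by (simp add: ip_dist_def)
qed

definition closed_subspace :: "'a set \<Rightarrow> bool" where
  "closed_subspace V \<longleftrightarrow> V \<subseteq> carrier H \<and> \<zero> \<in> V \<and>
     (\<forall>x\<in>V. \<forall>y\<in>V. x \<oplus> y \<in> V) \<and> (\<forall>r. \<forall>x\<in>V. r \<odot>\<^bsub>H\<^esub> x \<in> V) \<and>
     (\<forall>\<sigma>. \<forall>l\<in>carrier H. range \<sigma> \<subseteq> V \<longrightarrow> (\<lambda>n. ip_dist H (\<sigma> n) l) \<longlonglongrightarrow> 0 \<longrightarrow> l \<in> V)"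

lemma closed_subspace_diff:
  assumes V: "closed_subspace V" "x \<in> V" "y \<in> V"
  shows "x \<ominus> y \<in> V"
proof -
  have [simp]: "x \<in> carrier H" "y \<in> carrier H"
    using V by (auto simp: closed_subspace_def)
  have "x \<ominus> y = x \<oplus> (-1) \<odot>\<^bsub>H\<^esub> y"
    by (rule vector_eqI) (simp_all add: ip_left)
  then show ?thesis
    using V unfolding closed_subspace_def by simp
qed

definition transport :: "'a set \<Rightarrow> ('a \<Rightarrow> 'v) \<Rightarrow> 'v inner_space" where
  "transport V \<Phi> = (let \<Psi> = inv_into V \<Phi> in
     \<lparr>carrier = \<Phi> ` V, mult = (\<lambda>a b. \<Phi> \<zero>), one = \<Phi> \<zero>, zero = \<Phi> \<zero>,
      add = (\<lambda>a b. \<Phi> (\<Psi> a \<oplus> \<Psi> b)), smult = (\<lambda>r a. \<Phi> (r \<odot>\<^bsub>H\<^esub> \<Psi> a)),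
      ip = (\<lambda>a b. ip H (\<Psi> a) (\<Psi> b))\<rparr>)"

context
  fixes V :: "'a set" and \<Phi> :: "'a \<Rightarrow> 'v"
  assumes V: "closed_subspace V" and inj: "inj_on \<Phi> V"
begin

lemma transport_simps:
  "carrier (transport V \<Phi>) = \<Phi> ` V"
  "zero (transport V \<Phi>) = \<Phi> \<zero>"
  "\<lbrakk>u \<in> V; v \<in> V\<rbrakk> \<Longrightarrow> add (transport V \<Phi>) (\<Phi> u) (\<Phi> v) = \<Phi> (u \<oplus> v)"
  "v \<in> V \<Longrightarrow> smult (transport V \<Phi>) r (\<Phi> v) = \<Phi> (r \<odot>\<^bsub>H\<^esub> v)"
  "\<lbrakk>u \<in> V; v \<in> V\<rbrakk> \<Longrightarrow> ip (transport V \<Phi>) (\<Phi> u) (\<Phi> v) = ip H u v"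
  using inj by (simp_all add: transport_def Let_def)

lemma V_carrier: "v \<in> V \<Longrightarrow> v \<in> carrier H"
  and V_zero: "\<zero> \<in> V"
  and V_add: "\<lbrakk>u \<in> V; v \<in> V\<rbrakk> \<Longrightarrow> u \<oplus> v \<in> V"
  and V_smult: "v \<in> V \<Longrightarrow> r \<odot>\<^bsub>H\<^esub> v \<in> V"
  using V by (auto simp: closed_subspace_def)

lemma pre_hilbert_transport: "pre_hilbert_space (transport V \<Phi>)"
proof -
  note [simp] = transport_simps V_carrier V_zero V_add V_smult
  have "abelian_group (transport V \<Phi>)"
  proof (rule abelian_groupI)
    fix a assume "a \<in> carrier (transport V \<Phi>)"
    then obtain v where v: "v \<in> V" "a = \<Phi> v" by auto
    have "(-1) \<odot>\<^bsub>H\<^esub> v \<oplus> v = \<zero>"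
      using v by (intro vector_eqI) (simp_all add: ip_left)
    then show "\<exists>b\<in>carrier (transport V \<Phi>). b \<oplus>\<^bsub>transport V \<Phi>\<^esub> a = \<zero>\<^bsub>transport V \<Phi>\<^esub>"
      using v by (intro bexI[of _ "\<Phi> ((-1) \<odot>\<^bsub>H\<^esub> v)"]) simp_all
  qed (auto simp: M.a_ac)
  then have "Module.module real_ring (transport V \<Phi>)"
  proof (rule Module.moduleI[OF cring_real_ring])
    show "(a \<oplus>\<^bsub>real_ring\<^esub> b) \<odot>\<^bsub>transport V \<Phi>\<^esub> x =
      a \<odot>\<^bsub>transport V \<Phi>\<^esub> x \<oplus>\<^bsub>transport V \<Phi>\<^esub> b \<odot>\<^bsub>transport V \<Phi>\<^esub> x"
      if "x \<in> carrier (transport V \<Phi>)" for a b x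
      using that smult_l_distr by auto
    show "(a \<otimes>\<^bsub>real_ring\<^esub> b) \<odot>\<^bsub>transport V \<Phi>\<^esub> x =
      a \<odot>\<^bsub>transport V \<Phi>\<^esub> (b \<odot>\<^bsub>transport V \<Phi>\<^esub> x)"
      if "x \<in> carrier (transport V \<Phi>)" for a b x
      using that smult_assoc1 by auto
    show "\<one>\<^bsub>real_ring\<^esub> \<odot>\<^bsub>transport V \<Phi>\<^esub> x = x" if "x \<in> carrier (transport V \<Phi>)" for x
      using that smult_one by auto
  qed (auto simp: smult_r_distr)
  then show ?thesis
  proof (intro pre_hilbert_space.intro pre_hilbert_space_axioms.intro)
    show "ip (transport V \<Phi>) x y = ip (transport V \<Phi>) y x"
      if "x \<in> carrier (transport V \<Phi>)" "y \<in> carrier (transport V \<Phi>)" for x y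
      using that by (auto simp: ip_commute)
    show "x = \<zero>\<^bsub>transport V \<Phi>\<^esub>"
      if "x \<in> carrier (transport V \<Phi>)" "ip (transport V \<Phi>) x x = 0" for x
    proof -
      obtain v where v: "v \<in> V" "x = \<Phi> v" using \<open>x \<in> carrier (transport V \<Phi>)\<close> by auto
      then have "v = \<zero>" using that(2) by (intro ip_definite) simp_all
      then show ?thesis using v by simp
    qed
  qed (auto simp: ip_left ip_nonneg)
qed

lemma ip_dist_transport:
  assumes "u \<in> V" "v \<in> V"
  shows "ip_dist (transport V \<Phi>) (\<Phi> u) (\<Phi> v) = ip_dist H u v"
  using assms pre_hilbert_space.ip_dist_expand[OF pre_hilbert_transport, of "\<Phi> u" "\<Phi> v"]
  by (simp add: transport_simps ip_dist_expand V_carrier)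

end

end

lemma (in hilbert_space) hilbert_transport:
  assumes V: "closed_subspace V" and inj: "inj_on \<Phi> V"
  shows "hilbert_space (transport V \<Phi>)"
proof (intro hilbert_space.intro hilbert_space_axioms.intro pre_hilbert_transport assms)
  fix \<sigma> :: "nat \<Rightarrow> 'c"
  assume range: "range \<sigma> \<subseteq> carrier (transport V \<Phi>)"
    and Cauchy: "\<forall>\<epsilon>>0. \<exists>N. \<forall>m\<ge>N. \<forall>n\<ge>N. ip_dist (transport V \<Phi>) (\<sigma> m) (\<sigma> n) < \<epsilon>"
  from range have "\<forall>n. \<exists>v\<in>V. \<sigma> n = \<Phi> v"
    by (auto simp: transport_simps[OF assms])
  then obtain \<tau> where \<tau>: "\<And>n. \<tau> n \<in> V" "\<And>n. \<sigma> n = \<Phi> (\<tau> n)"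
    by metis
  have "range \<tau> \<subseteq> carrier H"
    using \<tau> V_carrier[OF assms] by auto
  moreover have "\<forall>\<epsilon>>0. \<exists>N. \<forall>m\<ge>N. \<forall>n\<ge>N. ip_dist H (\<tau> m) (\<tau> n) < \<epsilon>"
    using Cauchy by (simp add: \<tau> ip_dist_transport[OF assms])
  ultimately obtain l where l: "l \<in> carrier H" "(\<lambda>n. ip_dist H (\<tau> n) l) \<longlonglongrightarrow> 0"
    using complete by blast
  then have "l \<in> V"
    using V \<tau>(1) unfolding closed_subspace_def by blast
  then show "\<exists>l\<in>carrier (transport V \<Phi>).
      (\<lambda>n. ip_dist (transport V \<Phi>) (\<sigma> n) l) \<longlonglongrightarrow> 0"
    using l \<tau> by (intro bexI[of _ "\<Phi> l"])
      (simp_all add: transport_simps[OF assms] ip_dist_transport[OF assms])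
qed

context pre_hilbert_space
begin

definition linear_part :: "('a \<Rightarrow> 'a) \<Rightarrow> 'a \<Rightarrow> 'a" where
  "linear_part T v = T v \<ominus> T \<zero>"

context
  fixes T
  assumes T: "affine_isometry H T" and T_in [simp]: "\<And>v. v \<in> carrier H \<Longrightarrow> T v \<in> carrier H"
begin

lemma affine_T:
  "\<lbrakk>x \<in> carrier H; y \<in> carrier H\<rbrakk> \<Longrightarrow>
    T ((1 - t) \<odot>\<^bsub>H\<^esub> x \<oplus> t \<odot>\<^bsub>H\<^esub> y) = (1 - t) \<odot>\<^bsub>H\<^esub> T x \<oplus> t \<odot>\<^bsub>H\<^esub> T y"
  using T by (simp add: affine_isometry_def)

lemma linear_part_in [simp]: "v \<in> carrier H \<Longrightarrow> linear_part T v \<in> carrier H"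
  by (simp add: linear_part_def)

lemma linear_part_smult:
  assumes [simp]: "v \<in> carrier H"
  shows "linear_part T (t \<odot>\<^bsub>H\<^esub> v) = t \<odot>\<^bsub>H\<^esub> linear_part T v"
proof -
  have "t \<odot>\<^bsub>H\<^esub> v = (1 - t) \<odot>\<^bsub>H\<^esub> \<zero> \<oplus> t \<odot>\<^bsub>H\<^esub> v"
    by (rule vector_eqI) (simp_all add: ip_left)
  then have "T (t \<odot>\<^bsub>H\<^esub> v) = (1 - t) \<odot>\<^bsub>H\<^esub> T \<zero> \<oplus> t \<odot>\<^bsub>H\<^esub> T v"
    using affine_T[of \<zero> v t] by simp
  then show ?thesis
    unfolding linear_part_def
    by (intro vector_eqI) (simp_all add: ip_left algebra_simps)
qed

lemma linear_part_add:
  assumes [simp]: "u \<in> carrier H" "v \<in> carrier H"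
  shows "linear_part T (u \<oplus> v) = linear_part T u \<oplus> linear_part T v"
proof -
  let ?w = "(1 - 1/2) \<odot>\<^bsub>H\<^esub> u \<oplus> (1/2) \<odot>\<^bsub>H\<^esub> v"
  have "u \<oplus> v = 2 \<odot>\<^bsub>H\<^esub> ?w"
    by (rule vector_eqI) (simp_all add: ip_left)
  then have "linear_part T (u \<oplus> v) = 2 \<odot>\<^bsub>H\<^esub> linear_part T ?w"
    by (simp add: linear_part_smult)
  also have "\<dots> = 2 \<odot>\<^bsub>H\<^esub> (((1 - 1/2) \<odot>\<^bsub>H\<^esub> T u \<oplus> (1/2) \<odot>\<^bsub>H\<^esub> T v) \<ominus> T \<zero>)"
    by (simp only: linear_part_def affine_T assms)
  also have "\<dots> = linear_part T u \<oplus> linear_part T v"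
    unfolding linear_part_def
    by (intro vector_eqI) (simp_all add: ip_left algebra_simps)
  finally show ?thesis .
qed

lemma ip_dist_linear_part:
  assumes "u \<in> carrier H" "v \<in> carrier H"
  shows "ip_dist H (linear_part T u) (linear_part T v) = ip_dist H u v"
  using T assms by (simp add: linear_part_def ip_dist_translate affine_isometry_def)

lemma closed_subspace_linear_vimage:
  assumes V: "closed_subspace V"
  shows "closed_subspace {v \<in> carrier H. linear_part T v \<in> V}"
  unfolding closed_subspace_def
proof (intro conjI ballI allI impI)
  have "linear_part T \<zero> = \<zero>"
    by (simp add: linear_part_def a_minus_def M.r_neg)
  then show "\<zero> \<in> {v \<in> carrier H. linear_part T v \<in> V}"
    using V by (simp add: closed_subspace_def)
next
  fix \<sigma> :: "nat \<Rightarrow> 'a" and l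
  assume \<sigma>: "range \<sigma> \<subseteq> {v \<in> carrier H. linear_part T v \<in> V}" "l \<in> carrier H"
    "(\<lambda>n. ip_dist H (\<sigma> n) l) \<longlonglongrightarrow> 0"
  have "\<sigma> n \<in> carrier H" "linear_part T (\<sigma> n) \<in> V" for n
    using \<sigma>(1) by auto
  with \<sigma> have "range (\<lambda>n. linear_part T (\<sigma> n)) \<subseteq> V"
    "(\<lambda>n. ip_dist H (linear_part T (\<sigma> n)) (linear_part T l)) \<longlonglongrightarrow> 0"
    by (auto simp: ip_dist_linear_part)
  then have "linear_part T l \<in> V"
    using V \<sigma>(2) linear_part_in unfolding closed_subspace_def by blast
  then show "l \<in> {v \<in> carrier H. linear_part T v \<in> V}"
    using \<sigma>(2) by simp
qed (use V in \<open>auto simp: closed_subspace_def linear_part_add linear_part_smult\<close>)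

end

lemma closed_subspace_orthogonal:
  assumes [simp]: "w \<in> carrier H"
  shows "closed_subspace {v \<in> carrier H. ip H w v = 0}"
  unfolding closed_subspace_def
proof (intro conjI ballI allI impI)
  fix \<sigma> :: "nat \<Rightarrow> 'a" and l
  assume \<sigma>: "range \<sigma> \<subseteq> {v \<in> carrier H. ip H w v = 0}" and [simp]: "l \<in> carrier H"
    and lim: "(\<lambda>n. ip_dist H (\<sigma> n) l) \<longlonglongrightarrow> 0"
  have [simp]: "\<sigma> n \<in> carrier H" "ip H w (\<sigma> n) = 0" for n
    using \<sigma> by auto
  have "\<bar>ip H w l\<bar> \<le> sqrt (ip H w w) * ip_dist H (\<sigma> n) l" for n
    using Cauchy_Schwarz[of w "\<sigma> n \<ominus> l"] by (simp add: ip_right ip_dist_def)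
  moreover have "(\<lambda>n. sqrt (ip H w w) * ip_dist H (\<sigma> n) l) \<longlonglongrightarrow> sqrt (ip H w w) * 0"
    by (intro tendsto_intros lim)
  ultimately have "\<bar>ip H w l\<bar> \<le> sqrt (ip H w w) * 0"
    by (intro tendsto_lowerbound[where F = sequentially]) auto
  then show "l \<in> {v \<in> carrier H. ip H w v = 0}" by simp
qed (auto simp: ip_right)

end

definition type_inner_space :: "'b::real_inner inner_space" where
  "type_inner_space = \<lparr>carrier = UNIV, mult = (\<lambda>x y. 0), one = 0, zero = 0, add = (+),
     smult = (*\<^sub>R), ip = inner\<rparr>"

lemma hilbert_type_inner_space:
  "hilbert_space (type_inner_space :: 'b::{real_inner,complete_space} inner_space)"
    (is "hilbert_space ?H")
proof -
  have [simp]: "carrier ?H = UNIV" "zero ?H = 0" "add ?H = (+)" "smult ?H = (*\<^sub>R)" "ip ?H = inner"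
    by (simp_all add: type_inner_space_def)
  have "abelian_group ?H"
    by (rule abelian_groupI) (auto simp: algebra_simps intro: exI[of _ "- _"])
  then have "Module.module real_ring ?H"
    by (rule Module.moduleI[OF cring_real_ring]) (simp_all add: algebra_simps)
  then interpret pre_hilbert_space ?H
    by (intro pre_hilbert_space.intro pre_hilbert_space_axioms.intro)
      (auto simp: inner_add_left intro: inner_commute)
  have dist: "ip_dist ?H x y = dist x y" for x y :: 'b
    by (simp add: ip_dist_expand dist_norm norm_eq_sqrt_inner inner_diff_left inner_diff_right
        inner_commute[of y x])
  show ?thesis
  proof
    fix \<sigma> :: "nat \<Rightarrow> 'b"
    assume "\<forall>\<epsilon>>0. \<exists>N. \<forall>m\<ge>N. \<forall>n\<ge>N. ip_dist ?H (\<sigma> m) (\<sigma> n) < \<epsilon>"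
    then have "Cauchy \<sigma>"
      unfolding dist Cauchy_def .
    then obtain l where "\<sigma> \<longlonglongrightarrow> l"
      using Cauchy_convergent convergent_def by blast
    then have "(\<lambda>n. ip_dist ?H (\<sigma> n) l) \<longlonglongrightarrow> 0"
      unfolding dist using tendsto_dist_iff by blast
    then show "\<exists>l\<in>carrier ?H. (\<lambda>n. ip_dist ?H (\<sigma> n) l) \<longlonglongrightarrow> 0"
      by (rule bexI) simp
  qed
qed

lemma equivariant_uniform_embedding_transfer:
  fixes G :: "('g, 'm) monoid_scheme" and H :: "('u, 'n) inner_space_scheme"
  assumes G: "group G" and H: "hilbert_space H"
    and emb: "equivariant_uniform_embedding G S H f"
  obtains H' :: "('g \<Rightarrow> real) inner_space" and f' where
    "hilbert_space H'" "equivariant_uniform_embedding G S H' f'"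
    "compression_exponent G S H' f' = compression_exponent G S H f"
proof -
  interpret G: group G by (rule G)
  interpret hilbert_space H by (rule H)
  let ?e = "\<one>\<^bsub>G\<^esub>"
  obtain \<pi> where \<pi>: "\<pi> \<in> hom G (Isom H)"
    and equiv: "\<And>g x. \<lbrakk>g \<in> carrier G; x \<in> carrier G\<rbrakk> \<Longrightarrow> f (g \<otimes>\<^bsub>G\<^esub> x) = \<pi> g (f x)"
    using emb by (auto simp: equivariant_uniform_embedding_def)
  have f_in [simp]: "x \<in> carrier G \<Longrightarrow> f x \<in> carrier H" for x
    using emb by (auto simp: equivariant_uniform_embedding_def)
  have \<pi>_Bij: "\<pi> g \<in> Bij (carrier H)" and \<pi>_aff: "affine_isometry H (\<pi> g)"
    if "g \<in> carrier G" for g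
    using \<pi> that by (auto simp: hom_def Isom_def)
  have \<pi>_in [simp]: "\<pi> g v \<in> carrier H" if "g \<in> carrier G" "v \<in> carrier H" for g v
    using \<pi>_Bij[OF that(1)] that(2) Bij_imp_funcset by blast
  have \<pi>_mult: "\<pi> (g \<otimes>\<^bsub>G\<^esub> h) v = \<pi> g (\<pi> h v)"
    if "g \<in> carrier G" "h \<in> carrier G" "v \<in> carrier H" for g h v
    using \<pi> that \<pi>_Bij by (simp add: hom_def Isom_def BijGroup_def compose_def)
  have \<pi>_one: "\<pi> ?e v = v" if "v \<in> carrier H" for v
  proof -
    have "inj_on (\<pi> ?e) (carrier H)"
      using \<pi>_Bij[of ?e] by (simp add: Bij_def bij_betw_def)
    then show ?thesis
      using \<pi>_mult[of ?e ?e v] that by (simp add: inj_on_eq_iff)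
  qed

  define F where "F x = f x \<ominus>\<^bsub>H\<^esub> f ?e" for x
  have F_in [simp]: "x \<in> carrier G \<Longrightarrow> F x \<in> carrier H" for x
    by (simp add: F_def)
  define V where "V = \<Inter>{W. closed_subspace W \<and> F ` carrier G \<subseteq> W}"
  have V_min: "V \<subseteq> W" if "closed_subspace W" "F ` carrier G \<subseteq> W" for W
    using that by (auto simp: V_def)
  have V_carrier: "V \<subseteq> carrier H"
    by (rule V_min) (auto simp: closed_subspace_def)
  then have [simp]: "v \<in> V \<Longrightarrow> v \<in> carrier H" for v by blast
  have V: "closed_subspace V"
    unfolding closed_subspace_def
  proof (intro conjI V_carrier ballI allI impI)
    fix \<sigma> :: "nat \<Rightarrow> 'u" and l
    assume \<sigma>: "range \<sigma> \<subseteq> V" "l \<in> carrier H" "(\<lambda>n. ip_dist H (\<sigma> n) l) \<longlonglongrightarrow> 0"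
    show "l \<in> V"
      unfolding V_def
    proof (intro InterI, clarify)
      fix W assume W: "closed_subspace W" "F ` carrier G \<subseteq> W"
      then have "range \<sigma> \<subseteq> W" using \<sigma>(1) V_min by blast
      then show "l \<in> W" using W(1) \<sigma> unfolding closed_subspace_def by blast
    qed
  next
    show "\<zero>\<^bsub>H\<^esub> \<in> V"
      unfolding V_def by (intro InterI) (simp add: closed_subspace_def)
    show "x \<oplus>\<^bsub>H\<^esub> y \<in> V" if "x \<in> V" "y \<in> V" for x y
      unfolding V_def
    proof (intro InterI, clarify)
      fix W assume W: "closed_subspace W" "F ` carrier G \<subseteq> W"
      then have "x \<in> W" "y \<in> W" using that V_min by blast+
      then show "x \<oplus>\<^bsub>H\<^esub> y \<in> W" using W(1) by (simp add: closed_subspace_def)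
    qed
    show "r \<odot>\<^bsub>H\<^esub> x \<in> V" if "x \<in> V" for r x
      unfolding V_def
    proof (intro InterI, clarify)
      fix W assume W: "closed_subspace W" "F ` carrier G \<subseteq> W"
      then have "x \<in> W" using that V_min by blast
      then show "r \<odot>\<^bsub>H\<^esub> x \<in> W" using W(1) by (simp add: closed_subspace_def)
    qed
  qed
  have F_V: "x \<in> carrier G \<Longrightarrow> F x \<in> V" for x
    by (auto simp: V_def)

  define \<Phi> where "\<Phi> v = (\<lambda>x. ip H v (F x))" for v
  have inj: "inj_on \<Phi> V"
  proof (rule inj_onI)
    fix u v assume uv: "u \<in> V" "v \<in> V" "\<Phi> u = \<Phi> v"
    define w where "w = u \<ominus>\<^bsub>H\<^esub> v"
    have w: "w \<in> V" using uv V by (simp add: w_def closed_subspace_diff)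
    have "ip H w (F x) = 0" if "x \<in> carrier G" for x
      using fun_cong[OF uv(3), of x] uv that by (simp add: w_def ip_diff_left \<Phi>_def)
    then have "V \<subseteq> {z \<in> carrier H. ip H w z = 0}"
      using w by (intro V_min closed_subspace_orthogonal) auto
    then have "w = \<zero>\<^bsub>H\<^esub>" using w by (intro ip_definite) auto
    then show "u = v"
      using uv eq_of_diff_eq_zero[of u v] by (simp add: w_def)
  qed
  define H' where "H' = transport V \<Phi>"
  define f' where "f' x = \<Phi> (F x)" for x
  note tr = transport_simps[OF V inj, folded H'_def]
  note dist_tr = ip_dist_transport[OF V inj, folded H'_def]
  have dist: "ip_dist H' (f' x) (f' y) = ip_dist H (f x) (f y)"
    if "x \<in> carrier G" "y \<in> carrier G" for x y
    using that by (simp add: f'_def dist_tr F_V) (simp add: F_def ip_dist_translate)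

  define A where "A g v = \<pi> g (v \<oplus>\<^bsub>H\<^esub> f ?e) \<ominus>\<^bsub>H\<^esub> f ?e" for g v
  have F_add: "F x \<oplus>\<^bsub>H\<^esub> f ?e = f x" if "x \<in> carrier G" for x
    using that by (intro vector_eqI) (simp_all add: F_def ip_left)
  have A_add: "A g v \<oplus>\<^bsub>H\<^esub> f ?e = \<pi> g (v \<oplus>\<^bsub>H\<^esub> f ?e)"
    if "g \<in> carrier G" "v \<in> carrier H" for g v
    using that by (intro vector_eqI) (simp_all add: A_def ip_left)
  have A_in [simp]: "A g v \<in> carrier H" if "g \<in> carrier G" "v \<in> carrier H" for g v
    using that by (simp add: A_def)
  have A_F: "A g (F x) = F (g \<otimes>\<^bsub>G\<^esub> x)" if "g \<in> carrier G" "x \<in> carrier G" for g x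
    using that by (simp add: A_def F_add equiv F_def[of "g \<otimes>\<^bsub>G\<^esub> x"])
  have A_mult: "A (g \<otimes>\<^bsub>G\<^esub> h) v = A g (A h v)"
    if "g \<in> carrier G" "h \<in> carrier G" "v \<in> carrier H" for g h v
  proof -
    have "A g (A h v) = \<pi> g (A h v \<oplus>\<^bsub>H\<^esub> f ?e) \<ominus>\<^bsub>H\<^esub> f ?e"
      by (simp add: A_def[of g])
    then show ?thesis
      using that by (simp add: A_add) (simp add: A_def \<pi>_mult)
  qed
  have A_one: "A ?e v = v" if "v \<in> carrier H" for v
    using that by (intro vector_eqI) (simp_all add: A_def \<pi>_one ip_left)
  have A_linear: "A g v = linear_part (\<pi> g) v \<oplus>\<^bsub>H\<^esub> F g"
    if g: "g \<in> carrier G" and v: "v \<in> carrier H" for g v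
  proof -
    have "linear_part (\<pi> g) (v \<oplus>\<^bsub>H\<^esub> f ?e) =
        linear_part (\<pi> g) v \<oplus>\<^bsub>H\<^esub> linear_part (\<pi> g) (f ?e)"
      using that by (intro linear_part_add) (auto intro: \<pi>_aff)
    then have "\<pi> g (v \<oplus>\<^bsub>H\<^esub> f ?e) \<ominus>\<^bsub>H\<^esub> \<pi> g \<zero>\<^bsub>H\<^esub> =
        linear_part (\<pi> g) v \<oplus>\<^bsub>H\<^esub> (f g \<ominus>\<^bsub>H\<^esub> \<pi> g \<zero>\<^bsub>H\<^esub>)"
      using g equiv[of g ?e] by (simp add: linear_part_def)
    then have eq: "ip H (\<pi> g (v \<oplus>\<^bsub>H\<^esub> f ?e) \<ominus>\<^bsub>H\<^esub> \<pi> g \<zero>\<^bsub>H\<^esub>) z =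
        ip H (linear_part (\<pi> g) v \<oplus>\<^bsub>H\<^esub> (f g \<ominus>\<^bsub>H\<^esub> \<pi> g \<zero>\<^bsub>H\<^esub>)) z" for z
      by simp
    have [simp]: "linear_part (\<pi> g) v \<in> carrier H"
      using g v by (simp add: linear_part_def)
    have "ip H (\<pi> g (v \<oplus>\<^bsub>H\<^esub> f ?e)) z = ip H (linear_part (\<pi> g) v) z + ip H (f g) z"
      if "z \<in> carrier H" for z
      using eq[of z] g v that by (simp add: ip_left)
    then show ?thesis
      using g v by (intro vector_eqI) (simp_all add: A_def F_def ip_left)
  qed
  have A_V: "A g v \<in> V" if g: "g \<in> carrier G" and v: "v \<in> V" for g v
  proof -
    have "linear_part (\<pi> g) (F x) \<in> V" if x: "x \<in> carrier G" for x
    proof -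
      have "linear_part (\<pi> g) (F x) = F (g \<otimes>\<^bsub>G\<^esub> x) \<ominus>\<^bsub>H\<^esub> F g"
        using A_F[OF g x] A_linear[OF g, of "F x"] g x
        by (intro vector_eqI) (simp_all add: linear_part_def ip_left flip: A_F)
      then show ?thesis
        using g x V by (simp add: closed_subspace_diff F_V)
    qed
    then have "V \<subseteq> {v \<in> carrier H. linear_part (\<pi> g) v \<in> V}"
      using g V by (intro V_min closed_subspace_linear_vimage) (auto intro: \<pi>_aff)
    then have "linear_part (\<pi> g) v \<in> V" using v by blast
    then show ?thesis
      using g v V F_V[OF g] by (simp add: A_linear closed_subspace_def)
  qed
  have A_dist: "ip_dist H (A g u) (A g v) = ip_dist H u v"
    if "g \<in> carrier G" "u \<in> carrier H" "v \<in> carrier H" for g u v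
  proof -
    have "ip_dist H (A g u) (A g v) = ip_dist H (u \<oplus>\<^bsub>H\<^esub> f ?e) (v \<oplus>\<^bsub>H\<^esub> f ?e)"
      using that \<pi>_aff[of g] by (simp add: A_def ip_dist_translate affine_isometry_def)
    also have "\<dots> = ip_dist H u v"
      using that by (simp add: ip_dist_expand ip_left ip_right ip_commute algebra_simps)
    finally show ?thesis .
  qed
  have A_affine: "A g ((1 - t) \<odot>\<^bsub>H\<^esub> u \<oplus>\<^bsub>H\<^esub> t \<odot>\<^bsub>H\<^esub> v) =
      (1 - t) \<odot>\<^bsub>H\<^esub> A g u \<oplus>\<^bsub>H\<^esub> t \<odot>\<^bsub>H\<^esub> A g v"
    if "g \<in> carrier G" "u \<in> carrier H" "v \<in> carrier H" for g u v t
  proof -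
    have "(1 - t) \<odot>\<^bsub>H\<^esub> u \<oplus>\<^bsub>H\<^esub> t \<odot>\<^bsub>H\<^esub> v \<oplus>\<^bsub>H\<^esub> f ?e =
        (1 - t) \<odot>\<^bsub>H\<^esub> (u \<oplus>\<^bsub>H\<^esub> f ?e) \<oplus>\<^bsub>H\<^esub> t \<odot>\<^bsub>H\<^esub> (v \<oplus>\<^bsub>H\<^esub> f ?e)"
      using that by (intro vector_eqI) (simp_all add: ip_left algebra_simps)
    then have "\<pi> g ((1 - t) \<odot>\<^bsub>H\<^esub> u \<oplus>\<^bsub>H\<^esub> t \<odot>\<^bsub>H\<^esub> v \<oplus>\<^bsub>H\<^esub> f ?e) =
        (1 - t) \<odot>\<^bsub>H\<^esub> \<pi> g (u \<oplus>\<^bsub>H\<^esub> f ?e) \<oplus>\<^bsub>H\<^esub> t \<odot>\<^bsub>H\<^esub> \<pi> g (v \<oplus>\<^bsub>H\<^esub> f ?e)"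
      using that \<pi>_aff[of g] by (simp add: affine_isometry_def)
    then show ?thesis
      using that by (intro vector_eqI) (simp_all add: A_def ip_left algebra_simps)
  qed

  define \<pi>' where "\<pi>' g = (\<lambda>a\<in>carrier H'. \<Phi> (A g (inv_into V \<Phi> a)))" for g
  have \<pi>'_\<Phi>: "\<pi>' g (\<Phi> v) = \<Phi> (A g v)" if "v \<in> V" for g v
    using that inj by (simp add: \<pi>'_def tr)
  have \<pi>'_Bij: "\<pi>' g \<in> Bij (carrier H')" if g: "g \<in> carrier G" for g
  proof -
    have "A (inv\<^bsub>G\<^esub> g) (A g v) = v" "A g (A (inv\<^bsub>G\<^esub> g) v) = v" if "v \<in> V" for v
      using that g by (simp_all add: A_one flip: A_mult)
    then have "bij_betw (\<pi>' g) (carrier H') (carrier H')"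
      using g by (intro bij_betw_byWitness[where f' = "\<pi>' (inv\<^bsub>G\<^esub> g)"])
        (auto simp: tr \<pi>'_\<Phi> A_V)
    then show ?thesis by (simp add: Bij_def \<pi>'_def)
  qed
  have \<pi>'_aff: "affine_isometry H' (\<pi>' g)" if g: "g \<in> carrier G" for g
  proof -
    have V_closed: "r \<odot>\<^bsub>H\<^esub> v \<in> V" "u \<oplus>\<^bsub>H\<^esub> v \<in> V" if "u \<in> V" "v \<in> V" for u v r
      using V that by (auto simp: closed_subspace_def)
    show ?thesis
      unfolding affine_isometry_def using g
      by (auto simp: tr \<pi>'_\<Phi> dist_tr A_V A_dist V_closed A_affine)
  qed
  have "\<pi>' (g \<otimes>\<^bsub>G\<^esub> h) = compose (carrier H') (\<pi>' g) (\<pi>' h)"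
    if "g \<in> carrier G" "h \<in> carrier G" for g h
  proof
    fix a
    show "\<pi>' (g \<otimes>\<^bsub>G\<^esub> h) a = compose (carrier H') (\<pi>' g) (\<pi>' h) a"
    proof (cases "a \<in> carrier H'")
      case True
      then show ?thesis
        using that by (auto simp: compose_def tr \<pi>'_\<Phi> A_V A_mult)
    qed (simp add: \<pi>'_def compose_def)
  qed
  then have \<pi>': "\<pi>' \<in> hom G (Isom H')"
    using \<pi>'_Bij \<pi>'_aff by (auto simp: hom_def Isom_def BijGroup_def)

  have compr: "compression_function G S H' f' = compression_function G S H f"
    by (intro ext) (simp add: compression_function_def dist)
  show thesis
  proof
    show "hilbert_space H'"
      unfolding H'_def by (rule hilbert_transport[OF V inj])
    have "f' \<in> carrier G \<rightarrow> carrier H'"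
      by (auto simp: f'_def tr F_V)
    moreover have "\<forall>g\<in>carrier G. \<forall>x\<in>carrier G. f' (g \<otimes>\<^bsub>G\<^esub> x) = \<pi>' g (f' x)"
      by (simp add: f'_def \<pi>'_\<Phi> F_V A_F)
    ultimately show "equivariant_uniform_embedding G S H' f'"
      using emb \<pi>' unfolding equivariant_uniform_embedding_def compr
      by (auto simp: dist)
    show "compression_exponent G S H' f' = compression_exponent G S H f"
      by (simp add: compression_exponent_def compr)
  qed
qed

lemma compression_exponent_bounds:
  shows compression_exponent_nonneg: "0 \<le> compression_exponent G S H f"
    and compression_exponent_le_1: "compression_exponent G S H f \<le> 1"
proof -
  show "0 \<le> compression_exponent G S H f"
    unfolding compression_exponent_def by (rule cSup_upper) (auto intro!: bdd_aboveI[of _ 1])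
  show "compression_exponent G S H f \<le> 1"
    unfolding compression_exponent_def by (rule cSup_least) auto
qed

theorem compression_exponent_le_equivariant:
  fixes G :: "('g, 'm) monoid_scheme" and H :: "('u, 'n) inner_space_scheme"
  assumes "group G" "hilbert_space H" "equivariant_uniform_embedding G S H f"
  shows "compression_exponent G S H f \<le> equivariant_compression_exponent G S"
proof -
  obtain H' :: "('g \<Rightarrow> real) inner_space" and f' where
    "hilbert_space H'" "equivariant_uniform_embedding G S H' f'"
    "compression_exponent G S H' f' = compression_exponent G S H f"
    using equivariant_uniform_embedding_transfer[OF assms] .
  then show ?thesis
    unfolding equivariant_compression_exponent_def
    by (intro cSup_upper) (auto intro!: bdd_aboveI[of _ 1] simp: compression_exponent_le_1)
qed

end

theory Submission
  imports Defs
begin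

text \<open>
  Let \<open>p n\<close> be the \<open>n\<close>-fold convolution power of the step distribution and let \<open>b n\<close> be the return
  probability at time \<open>2 n\<close>, which is the squared norm of \<open>p n\<close> in \<open>l\<^sup>2(G)\<close>.  The group acts on \<open>l\<^sup>2(G)\<close>
  by right translations, and it displaces the unit vector \<open>v n = p n / sqrt (b n)\<close> according to
  \<open>\<parallel>g \<sqdot> v n - v n\<parallel>\<^sup>2 = 2 (1 - p (2 n) (g\<inverse>) / b n)\<close>.  Let \<open>\<gamma> < 1\<close>, as the asserted bound is not positive
  otherwise.  Slow decay of \<open>b\<close> then has two consequences.

  Generators hardly move \<open>v n\<close>.  The sequence \<open>b\<close> is log-convex by Cauchy--Schwarz, so its relative
  decrement \<open>1 - b (n + 1) / b n\<close> is at most \<open>- ln (b n) / n\<close>, the average rate of decay so far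
  (\<open>log_convex_decay_rate\<close>).  This is \<open>O(n powr (\<gamma> - 1))\<close> by assumption, and up to a constant factor it
  bounds the displacement by a generator (\<open>generator_displacement\<close>); laziness enters in comparing the
  return probability at odd times with that at even times.

  Far elements move \<open>v n\<close> a lot.  The walk has Gaussian off-diagonal decay
  \<open>p (2 n) (g\<inverse>) \<le> exp (- |g|\<^sup>2 / (4 n))\<close>, the bound of Varopoulos and Carne, and this is at most
  \<open>b n / 2\<close> as soon as \<open>|g| \<ge> D n powr ((1 + \<gamma>) / 2)\<close>.  The proof of the Gaussian bound here follows
  Davies: the step operator increases the norm with weight \<open>exp (2 \<theta> |x|)\<close> by at most \<open>cosh \<theta>\<close>, which
  by laziness is a short computation with finite sums (\<open>weighted_avg_bound\<close>).

  For \<open>0 < \<theta> < 1 - \<gamma>\<close> the direct sum of the cocycles \<open>g \<sqdot> v n - v n\<close> with squared weights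
  \<open>(n + 1) powr (\<theta> - 1)\<close> then converges at the generators, hence everywhere, and it is the orbit map
  of an affine isometric action (\<open>virtual_coboundary_equivariant\<close>).  At \<open>g\<close>, the summands with
  \<open>n \<le> (|g| / D) powr (2 / (1 + \<gamma>))\<close> alone contribute at least \<open>(|g| / D) powr (2 \<theta> / (1 + \<gamma>))\<close> to the
  squared norm.  So the compression exponent is at least \<open>\<theta> / (1 + \<gamma>)\<close>, and \<open>\<theta>\<close> may tend to \<open>1 - \<gamma>\<close>.
\<close>

section \<open>The Hilbert space of square-summable functions\<close>

definition ell2 :: "('i \<Rightarrow> real) inner_space" where
  "ell2 = \<lparr>carrier = {x. (\<lambda>i. (x i)\<^sup>2) summable_on UNIV}, mult = (\<lambda>x y i. 0), one = (\<lambda>i. 0),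
     zero = (\<lambda>i. 0), add = (\<lambda>x y i. x i + y i), smult = (\<lambda>r x i. r * x i),
     ip = (\<lambda>x y. \<Sum>\<^sub>\<infinity>i. x i * y i)\<rparr>"

lemma ell2_simps [simp]:
  "zero ell2 = (\<lambda>i. 0)" "add ell2 = (\<lambda>x y i. x i + y i)" "smult ell2 = (\<lambda>r x i. r * x i)"
  "ip ell2 = (\<lambda>x y. \<Sum>\<^sub>\<infinity>i. x i * y i)"
  by (simp_all add: ell2_def)

lemma ell2_iff: "x \<in> carrier ell2 \<longleftrightarrow> (\<lambda>i. (x i)\<^sup>2) summable_on UNIV"
  by (simp add: ell2_def)

lemma summable_on_mult_of_squares:
  fixes f g :: "'i \<Rightarrow> real"
  assumes "(\<lambda>i. (f i)\<^sup>2) summable_on A" "(\<lambda>i. (g i)\<^sup>2) summable_on A"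
  shows "(\<lambda>i. f i * g i) summable_on A"
proof (rule abs_summable_summable, rule summable_on_comparison_test)
  show "(\<lambda>i. (f i)\<^sup>2 + (g i)\<^sup>2) summable_on A"
    using assms by (rule summable_on_add)
  show "norm (f i * g i) \<le> (f i)\<^sup>2 + (g i)\<^sup>2" for i
  proof -
    have "0 \<le> (\<bar>f i\<bar> - \<bar>g i\<bar>)\<^sup>2" by simp
    moreover have "0 \<le> \<bar>f i\<bar> * \<bar>g i\<bar>" by simp
    ultimately show ?thesis
      unfolding power2_diff real_norm_def abs_mult power2_abs by linarith
  qed
qed simp

lemma ell2_add:
  assumes "x \<in> carrier ell2" "y \<in> carrier ell2"
  shows "(\<lambda>i. x i + y i) \<in> carrier ell2"
proof -
  have "(\<lambda>i. (x i)\<^sup>2 + 2 * (x i * y i) + (y i)\<^sup>2) summable_on UNIV"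
    using assms
    by (intro summable_on_add summable_on_cmult_right summable_on_mult_of_squares)
       (simp_all add: ell2_iff)
  then show ?thesis by (simp add: ell2_iff power2_sum algebra_simps)
qed

lemma ell2_smult: "x \<in> carrier ell2 \<Longrightarrow> (\<lambda>i. r * x i) \<in> carrier ell2"
  by (simp add: ell2_iff power_mult_distrib summable_on_cmult_right)

lemma pre_hilbert_ell2: "pre_hilbert_space ell2"
proof -
  have "abelian_group ell2"
  proof (rule abelian_groupI)
    show "\<exists>y\<in>carrier ell2. y \<oplus>\<^bsub>ell2\<^esub> x = \<zero>\<^bsub>ell2\<^esub>" if "x \<in> carrier ell2" for x
      using ell2_smult[OF that, of "-1"] by (intro bexI[of _ "\<lambda>i. - 1 * x i"]) simp_all
    show "\<zero>\<^bsub>ell2\<^esub> \<in> carrier ell2" by (simp add: ell2_iff)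
  qed (auto simp: algebra_simps ell2_add)
  then have "Module.module real_ring ell2"
    by (rule Module.moduleI[OF cring_real_ring]) (simp_all add: algebra_simps ell2_smult)
  then show ?thesis
  proof (intro pre_hilbert_space.intro pre_hilbert_space_axioms.intro)
    fix x y z :: "'i \<Rightarrow> real" and r
    assume *: "x \<in> carrier ell2" "y \<in> carrier ell2"
    show "ip ell2 x y = ip ell2 y x" by (simp add: mult.commute)
    show "ip ell2 (r \<odot>\<^bsub>ell2\<^esub> x) y = r * ip ell2 x y"
      by (simp add: mult.assoc infsum_cmult_right')
    assume "z \<in> carrier ell2"
    with * show "ip ell2 (x \<oplus>\<^bsub>ell2\<^esub> y) z = ip ell2 x z + ip ell2 y z"
      by (simp add: ell2_iff distrib_right infsum_add summable_on_mult_of_squares)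
  next
    fix x :: "'i \<Rightarrow> real"
    assume x: "x \<in> carrier ell2"
    show "0 \<le> ip ell2 x x" by (simp add: infsum_nonneg)
    assume "ip ell2 x x = 0"
    then have "(x i)\<^sup>2 = 0" for i
      using x by (intro nonneg_infsum_le_0D[where A = UNIV and f = "\<lambda>i. (x i)\<^sup>2"])
        (simp_all add: ell2_iff power2_eq_square)
    then show "x = \<zero>\<^bsub>ell2\<^esub>" by (simp add: fun_eq_iff)
  qed
qed

lemma ell2_minus:
  assumes "x \<in> carrier ell2" "y \<in> carrier ell2"
  shows "x \<ominus>\<^bsub>ell2\<^esub> y = (\<lambda>i. x i - y i)"
proof -
  interpret pre_hilbert_space ell2 by (rule pre_hilbert_ell2)
  have y: "(\<lambda>i. - 1 * y i) \<in> carrier ell2" using assms(2) by (rule ell2_smult)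
  have "\<ominus>\<^bsub>ell2\<^esub> y = (\<lambda>i. - 1 * y i)"
    using assms y by (intro M.minus_equality) simp_all
  then show ?thesis by (simp add: a_minus_def)
qed

lemma ip_dist_ell2:
  assumes "x \<in> carrier ell2" "y \<in> carrier ell2"
  shows "ip_dist ell2 x y = sqrt (\<Sum>\<^sub>\<infinity>i. (x i - y i)\<^sup>2)"
  using assms by (simp add: ip_dist_def ell2_minus power2_eq_square)

lemma ell2_diff:
  assumes "x \<in> carrier ell2" "y \<in> carrier ell2"
  shows "(\<lambda>i. x i - y i) \<in> carrier ell2"
  using ell2_add[OF assms(1) ell2_smult[OF assms(2), of "-1"]] by simp

text \<open>
  A Cauchy sequence converges at every index, and the pointwise limit is the limit in norm because
  the Cauchy estimate bounds every finite partial sum of squares, where one of the two indices of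
  the sequence may be sent to infinity.
\<close>

theorem hilbert_ell2: "hilbert_space ell2"
proof (intro hilbert_space.intro hilbert_space_axioms.intro pre_hilbert_ell2)
  fix \<sigma> :: "nat \<Rightarrow> 'i \<Rightarrow> real"
  assume "range \<sigma> \<subseteq> carrier ell2"
    and Cauchy: "\<forall>\<epsilon>>0. \<exists>N. \<forall>m\<ge>N. \<forall>n\<ge>N. ip_dist ell2 (\<sigma> m) (\<sigma> n) < \<epsilon>"
  then have \<sigma>: "\<sigma> n \<in> carrier ell2" for n by auto
  have partial: "(\<Sum>i\<in>F. (\<sigma> m i - \<sigma> n i)\<^sup>2) \<le> (ip_dist ell2 (\<sigma> m) (\<sigma> n))\<^sup>2"
    if "finite F" for F m n
  proof -
    have "(\<Sum>i\<in>F. (\<sigma> m i - \<sigma> n i)\<^sup>2) \<le> (\<Sum>\<^sub>\<infinity>i. (\<sigma> m i - \<sigma> n i)\<^sup>2)"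
      using ell2_diff[OF \<sigma>[of m] \<sigma>[of n]] that by (intro finite_sum_le_infsum) (auto simp: ell2_iff)
    then show ?thesis by (simp add: ip_dist_ell2 \<sigma> infsum_nonneg)
  qed
  have "convergent (\<lambda>n. \<sigma> n i)" for i
  proof -
    have "dist (\<sigma> m i) (\<sigma> n i) \<le> ip_dist ell2 (\<sigma> m) (\<sigma> n)" for m n
      using partial[of "{i}" m n]
      by (auto simp: dist_real_def ip_dist_ell2 \<sigma> infsum_nonneg intro!: real_le_rsqrt)
    then have "Cauchy (\<lambda>n. \<sigma> n i)"
      using Cauchy unfolding Cauchy_def by (meson order_le_less_trans)
    then show ?thesis by (simp add: Cauchy_convergent_iff)
  qed
  then obtain l where l: "\<And>i. (\<lambda>n. \<sigma> n i) \<longlonglongrightarrow> l i"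
    unfolding convergent_def by metis
  have bound: "\<exists>N. \<forall>m\<ge>N. (\<lambda>i. \<sigma> m i - l i) \<in> carrier ell2 \<and>
      (\<Sum>\<^sub>\<infinity>i. (\<sigma> m i - l i)\<^sup>2) \<le> \<epsilon>\<^sup>2" if "\<epsilon> > 0" for \<epsilon>
  proof -
    obtain N where N: "\<And>m n. \<lbrakk>m \<ge> N; n \<ge> N\<rbrakk> \<Longrightarrow> ip_dist ell2 (\<sigma> m) (\<sigma> n) < \<epsilon>"
      using Cauchy \<open>\<epsilon> > 0\<close> by blast
    have fin: "(\<Sum>i\<in>F. (\<sigma> m i - l i)\<^sup>2) \<le> \<epsilon>\<^sup>2" if "finite F" "m \<ge> N" for F m
    proof (rule tendsto_upperbound)
      show "(\<lambda>n. \<Sum>i\<in>F. (\<sigma> m i - \<sigma> n i)\<^sup>2) \<longlonglongrightarrow> (\<Sum>i\<in>F. (\<sigma> m i - l i)\<^sup>2)"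
        by (intro tendsto_intros l)
      have "(\<Sum>i\<in>F. (\<sigma> m i - \<sigma> n i)\<^sup>2) \<le> \<epsilon>\<^sup>2" if "n \<ge> N" for n
      proof -
        have "(ip_dist ell2 (\<sigma> m) (\<sigma> n))\<^sup>2 \<le> \<epsilon>\<^sup>2"
          using N[OF \<open>m \<ge> N\<close> that] by (intro power_mono) (simp_all add: ip_dist_ell2 \<sigma> infsum_nonneg)
        with partial[OF \<open>finite F\<close>, of m n] show ?thesis by linarith
      qed
      then show "\<forall>\<^sub>F n in sequentially. (\<Sum>i\<in>F. (\<sigma> m i - \<sigma> n i)\<^sup>2) \<le> \<epsilon>\<^sup>2"
        by (auto simp: eventually_sequentially)
    qed simp
    have "(\<lambda>i. \<sigma> m i - l i) \<in> carrier ell2" if "m \<ge> N" for m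
      unfolding ell2_iff
      by (rule nonneg_bounded_partial_sums_imp_summable_on[where C = "\<epsilon>\<^sup>2"])
         (auto intro!: eventually_finite_subsets_at_top_weakI fin that)
    then show ?thesis
      by (intro exI[of _ N]) (auto intro!: infsum_le_finite_sums fin simp: ell2_iff)
  qed
  obtain N where "(\<lambda>i. \<sigma> N i - l i) \<in> carrier ell2"
    using bound[of 1] by auto
  then have lc: "l \<in> carrier ell2"
    using ell2_diff[OF \<sigma>[of N]] by fastforce
  show "\<exists>l\<in>carrier ell2. (\<lambda>n. ip_dist ell2 (\<sigma> n) l) \<longlonglongrightarrow> 0"
  proof (rule bexI[OF _ lc], rule LIMSEQ_I)
    fix r :: real assume "r > 0"
    then obtain N where "\<And>m. m \<ge> N \<Longrightarrow> (\<Sum>\<^sub>\<infinity>i. (\<sigma> m i - l i)\<^sup>2) \<le> (r/2)\<^sup>2"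
      using bound[of "r/2"] by auto
    then have "ip_dist ell2 (\<sigma> m) l \<le> r/2" if "m \<ge> N" for m
      unfolding ip_dist_ell2[OF \<sigma> lc] using that \<open>r > 0\<close> by (intro real_le_lsqrt) simp_all
    then show "\<exists>N. \<forall>n\<ge>N. norm (ip_dist ell2 (\<sigma> n) l - 0) < r"
      using \<open>r > 0\<close> by (intro exI[of _ N]) (fastforce simp: ip_dist_ell2 \<sigma> lc infsum_nonneg)
  qed
qed

lemma (in pre_hilbert_space) ip_dist_triangle:
  assumes [simp]: "x \<in> carrier H" "y \<in> carrier H" "z \<in> carrier H"
  shows "ip_dist H x z \<le> ip_dist H x y + ip_dist H y z"
proof -
  define u v where "u = x \<ominus> y" and "v = y \<ominus> z"
  have [simp]: "u \<in> carrier H" "v \<in> carrier H" by (simp_all add: u_def v_def)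
  have xz: "x \<ominus> z = u \<oplus> v"
    by (rule vector_eqI) (simp_all add: u_def v_def ip_left)
  have "ip H (u \<oplus> v) (u \<oplus> v) = ip H u u + 2 * ip H u v + ip H v v"
    by (simp add: ip_left ip_right ip_commute[of v u])
  also have "\<dots> \<le> (sqrt (ip H u u) + sqrt (ip H v v))\<^sup>2"
    using Cauchy_Schwarz[of u v] by (simp add: power2_sum ip_nonneg)
  finally have "sqrt (ip H (u \<oplus> v) (u \<oplus> v)) \<le> sqrt (ip H u u) + sqrt (ip H v v)"
    by (intro real_le_lsqrt) (simp_all add: ip_nonneg)
  then show ?thesis
    unfolding ip_dist_def xz by (simp add: u_def v_def)
qed

section \<open>Word length\<close>

context group
begin

lemma foldr_mult_closed: "set ws \<subseteq> carrier G \<Longrightarrow> foldr (\<otimes>) ws \<one> \<in> carrier G"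
  by (induction ws) auto

lemma foldr_mult_append:
  "\<lbrakk>set us \<subseteq> carrier G; set ws \<subseteq> carrier G\<rbrakk> \<Longrightarrow>
    foldr (\<otimes>) (us @ ws) \<one> = foldr (\<otimes>) us \<one> \<otimes> foldr (\<otimes>) ws \<one>"
  by (induction us) (auto simp: foldr_mult_closed m_assoc)

lemma word_length_attained:
  assumes S: "finite_symmetric_generating_set G S" and g: "g \<in> carrier G"
  obtains ws where "length ws = word_length G S g" "set ws \<subseteq> S" "foldr (\<otimes>) ws \<one> = g"
proof -
  have SG: "S \<subseteq> carrier G" and inv: "\<And>s. s \<in> S \<Longrightarrow> inv s \<in> S" and "g \<in> generate G S"
    using S g by (auto simp: finite_symmetric_generating_set_def)
  from \<open>g \<in> generate G S\<close> have "\<exists>ws. set ws \<subseteq> S \<and> foldr (\<otimes>) ws \<one> = g"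
  proof induction
    case one
    show ?case by (intro exI[of _ "[]"]) simp
  next
    case (incl s)
    then show ?case using SG by (intro exI[of _ "[s]"]) auto
  next
    case (inv s)
    then show ?case using SG assms(1)
      by (intro exI[of _ "[inv s]"]) (auto simp: finite_symmetric_generating_set_def)
  next
    case (eng g h)
    then obtain us ws where "set us \<subseteq> S" "foldr (\<otimes>) us \<one> = g" "set ws \<subseteq> S" "foldr (\<otimes>) ws \<one> = h"
      by blast
    then show ?case using SG by (intro exI[of _ "us @ ws"]) (simp add: foldr_mult_append del: foldr_append)
  qed
  then have "\<exists>n ws. length ws = n \<and> set ws \<subseteq> S \<and> foldr (\<otimes>) ws \<one> = g" by blast
  from LeastI_ex[OF this] show ?thesis
    using that unfolding word_length_def by blast
qed

lemma word_length_le: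
  "\<lbrakk>set ws \<subseteq> S; foldr (\<otimes>) ws \<one> = g\<rbrakk> \<Longrightarrow> word_length G S g \<le> length ws"
  unfolding word_length_def by (rule Least_le) blast

lemma word_length_one [simp]: "word_length G S \<one> = 0"
  using word_length_le[of "[]" S \<one>] by simp

lemma word_length_mult_le:
  assumes S: "finite_symmetric_generating_set G S" and "s \<in> S" "g \<in> carrier G"
  shows "word_length G S (s \<otimes> g) \<le> word_length G S g + 1"
proof -
  obtain ws where "length ws = word_length G S g" "set ws \<subseteq> S" "foldr (\<otimes>) ws \<one> = g"
    using word_length_attained[OF S \<open>g \<in> carrier G\<close>] .
  then show ?thesis
    using word_length_le[of "s # ws" S "s \<otimes> g"] \<open>s \<in> S\<close> by simp
qed

text \<open>
  Both directions of the inequality come from prepending one letter to a shortest word, since the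
  inverse of a generator is again a letter.
\<close>

lemma word_length_generator_step:
  assumes S: "finite_symmetric_generating_set G S" and s: "s \<in> S" and g: "g \<in> carrier G"
  shows "\<bar>real (word_length G S (s \<otimes> g)) - real (word_length G S g)\<bar> \<le> 1"
proof -
  have *: "s \<in> carrier G" "inv s \<in> S" "inv s \<otimes> (s \<otimes> g) = g"
    using S s g by (auto simp: finite_symmetric_generating_set_def m_assoc[symmetric])
  then show ?thesis
    using word_length_mult_le[OF S s g] word_length_mult_le[OF S \<open>inv s \<in> S\<close>, of "s \<otimes> g"] g
    by simp
qed

section \<open>Virtual coboundaries of permutation actions\<close>

text \<open>
  For a right action on the index set, the translates of a function \<open>\<phi>\<close> differ from \<open>\<phi>\<close> by
  \<open>b g\<close>, and \<open>b\<close> satisfies the cocycle identity \<open>b (g h) = g \<sqdot> b h + b g\<close>.  The function \<open>\<phi>\<close> itself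
  may be far from square summable (then \<open>b\<close> can be unbounded), but the cocycle identity expands
  \<open>b g\<close> along a word for \<open>g\<close>, so that square summability and the Lipschitz bound need to be known
  for generators only.  The affine action is translation by \<open>b g\<close> after permutation of indices.
\<close>

theorem virtual_coboundary_equivariant:
  fixes \<phi> :: "'i \<Rightarrow> real" and act :: "'a \<Rightarrow> 'i \<Rightarrow> 'i"
  assumes S: "finite_symmetric_generating_set G S"
    and act_one: "\<And>i. act \<one> i = i"
    and act_mult: "\<And>g h i. \<lbrakk>g \<in> carrier G; h \<in> carrier G\<rbrakk> \<Longrightarrow> act (g \<otimes> h) i = act h (act g i)"
    and gen: "\<And>s. s \<in> S \<Longrightarrow> (\<lambda>i. (\<phi> (act s i) - \<phi> i)\<^sup>2) summable_on UNIV"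
  defines "b \<equiv> \<lambda>g i. \<phi> (act g i) - \<phi> i"
  shows virtual_coboundary_ell2: "\<And>g. g \<in> carrier G \<Longrightarrow> b g \<in> carrier ell2"
    and virtual_coboundary_affine_action:
      "\<exists>\<pi>\<in>hom G (Isom ell2). \<forall>g\<in>carrier G. \<forall>x\<in>carrier G. b (g \<otimes> x) = \<pi> g (b x)"
    and virtual_coboundary_Lipschitz:
      "\<exists>C>0. \<forall>x\<in>carrier G. \<forall>y\<in>carrier G.
         ip_dist ell2 (b x) (b y) \<le> C * real (word_length G S (inv y \<otimes> x)) + C"
proof -
  interpret H: hilbert_space "ell2 :: ('i \<Rightarrow> real) inner_space" by (rule hilbert_ell2)
  have SG: "S \<subseteq> carrier G" and "finite S"
    using S by (auto simp: finite_symmetric_generating_set_def)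
  have act_inv: "act g (act (inv g) i) = i" "act (inv g) (act g i) = i" if "g \<in> carrier G" for g i
    using that by (simp_all add: act_mult[symmetric] act_one)
  then have bij: "bij (act g)" if "g \<in> carrier G" for g
    using that by (intro o_bij[of "act (inv g)"]) (auto simp: fun_eq_iff)
  have \<rho>_ell2: "(\<lambda>i. x (act g i)) \<in> carrier ell2" if "g \<in> carrier G" "x \<in> carrier ell2" for g x
    using that summable_on_reindex_bij_betw[OF bij, of g "\<lambda>i. (x i)\<^sup>2"] by (simp add: ell2_iff)
  have b_mult: "b (g \<otimes> h) = (\<lambda>i. b h (act g i) + b g i)" if "g \<in> carrier G" "h \<in> carrier G" for g h
    using that by (simp add: b_def act_mult)
  have b_one: "b \<one> = (\<lambda>i. 0)" by (simp add: b_def act_one)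
  have b_gen: "b s \<in> carrier ell2" if "s \<in> S" for s
    using gen[OF that] by (simp add: ell2_iff b_def)
  have b_word: "b (foldr (\<otimes>) ws \<one>) \<in> carrier ell2" if "set ws \<subseteq> S" for ws
    using that
  proof (induction ws)
    case Nil
    then show ?case by (simp add: b_one ell2_iff)
  next
    case (Cons s ws)
    then have "s \<in> carrier G" "foldr (\<otimes>) ws \<one> \<in> carrier G"
      using SG by (auto intro!: foldr_mult_closed)
    then show ?case using Cons by (auto simp: b_mult intro!: ell2_add \<rho>_ell2 b_gen)
  qed
  show b_ell2: "b g \<in> carrier ell2" if "g \<in> carrier G" for g
    using word_length_attained[OF S that] b_word by metis

  define \<pi> where "\<pi> g = (\<lambda>x\<in>carrier ell2. \<lambda>i. x (act g i) + b g i)" for g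
  have \<pi>_in: "\<pi> g x \<in> carrier ell2" if "g \<in> carrier G" "x \<in> carrier ell2" for g x
    using that by (simp add: \<pi>_def ell2_add \<rho>_ell2 b_ell2)
  have \<pi>_mult: "\<pi> (g \<otimes> h) x = \<pi> g (\<pi> h x)"
    if "g \<in> carrier G" "h \<in> carrier G" "x \<in> carrier ell2" for g h x
    using that \<pi>_in[of h x] by (simp add: \<pi>_def b_mult act_mult add.assoc)
  have \<pi>_one: "\<pi> \<one> x = x" if "x \<in> carrier ell2" for x
    using that by (simp add: \<pi>_def b_one act_one)
  have \<pi>_b: "b (g \<otimes> x) = \<pi> g (b x)" if "g \<in> carrier G" "x \<in> carrier G" for g x
    using that by (simp add: \<pi>_def b_mult b_ell2)
  have \<pi>_dist: "ip_dist ell2 (\<pi> g x) (\<pi> g y) = ip_dist ell2 x y"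
    if "g \<in> carrier G" "x \<in> carrier ell2" "y \<in> carrier ell2" for g x y
  proof -
    have "(\<Sum>\<^sub>\<infinity>i. (x (act g i) - y (act g i))\<^sup>2) = (\<Sum>\<^sub>\<infinity>i. (x i - y i)\<^sup>2)"
      using infsum_reindex_bij_betw[OF bij[OF that(1)], of "\<lambda>i. (x i - y i)\<^sup>2"] by simp
    then show ?thesis
      using that \<pi>_in[of g x] \<pi>_in[of g y] by (simp add: ip_dist_ell2) (simp add: \<pi>_def)
  qed
  have \<pi>_Bij: "\<pi> g \<in> Bij (carrier ell2)" if "g \<in> carrier G" for g
  proof -
    have "bij_betw (\<pi> g) (carrier ell2) (carrier ell2)"
      using that by (intro bij_betw_byWitness[where f' = "\<pi> (inv g)"])
        (auto simp: \<pi>_mult[symmetric] \<pi>_one \<pi>_in)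
    then show ?thesis by (simp add: Bij_def \<pi>_def)
  qed
  have "affine_isometry ell2 (\<pi> g)" if "g \<in> carrier G" for g
    unfolding affine_isometry_def
  proof (intro conjI ballI allI)
    fix x y :: "'i \<Rightarrow> real" and t
    assume xy: "x \<in> carrier ell2" "y \<in> carrier ell2"
    with that show "ip_dist ell2 (\<pi> g x) (\<pi> g y) = ip_dist ell2 x y" by (rule \<pi>_dist)
    have "(\<lambda>i. (1 - t) * x i + t * y i) \<in> carrier ell2"
      using xy by (intro ell2_add ell2_smult)
    then show "\<pi> g ((1 - t) \<odot>\<^bsub>ell2\<^esub> x \<oplus>\<^bsub>ell2\<^esub> t \<odot>\<^bsub>ell2\<^esub> y) =
        (1 - t) \<odot>\<^bsub>ell2\<^esub> \<pi> g x \<oplus>\<^bsub>ell2\<^esub> t \<odot>\<^bsub>ell2\<^esub> \<pi> g y"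
      using xy by (simp add: \<pi>_def) (simp add: algebra_simps)
  qed
  moreover have "\<pi> (g \<otimes> h) = compose (carrier ell2) (\<pi> g) (\<pi> h)"
    if "g \<in> carrier G" "h \<in> carrier G" for g h
  proof
    fix x show "\<pi> (g \<otimes> h) x = compose (carrier ell2) (\<pi> g) (\<pi> h) x"
      using \<pi>_mult[OF that] by (cases "x \<in> carrier ell2") (simp_all add: compose_def, simp add: \<pi>_def)
  qed
  ultimately have "\<pi> \<in> hom G (Isom ell2)"
    using \<pi>_Bij by (auto simp: hom_def Isom_def BijGroup_def)
  with \<pi>_b show "\<exists>\<pi>\<in>hom G (Isom ell2). \<forall>g\<in>carrier G. \<forall>x\<in>carrier G. b (g \<otimes> x) = \<pi> g (b x)"
    by blast

  define C where "C = (\<Sum>s\<in>S. ip_dist ell2 (b s) (b \<one>)) + 1"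
  have dist_nonneg: "0 \<le> ip_dist ell2 (b x) (b y)" if "x \<in> carrier G" "y \<in> carrier G" for x y
    using that by (simp add: ip_dist_ell2 b_ell2 infsum_nonneg)
  then have "C > 0"
    unfolding C_def using SG by (intro add_nonneg_pos sum_nonneg) auto
  have step: "ip_dist ell2 (b (y \<otimes> s)) (b y) \<le> C" if "y \<in> carrier G" "s \<in> S" for y s
  proof -
    have "b (y \<otimes> s) = \<pi> y (b s)" "b y = \<pi> y (b \<one>)"
      using that SG \<pi>_b[of y s] \<pi>_b[of y \<one>] by auto
    then have "ip_dist ell2 (b (y \<otimes> s)) (b y) = ip_dist ell2 (b s) (b \<one>)"
      using that SG b_ell2[of \<one>] by (simp add: \<pi>_dist b_gen)
    also have "\<dots> \<le> C"
      unfolding C_def using that SG \<open>finite S\<close> dist_nonneg member_le_sum[of s S "\<lambda>s. ip_dist ell2 (b s) (b \<one>)"]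
      by fastforce
    finally show ?thesis .
  qed
  have word: "ip_dist ell2 (b (y \<otimes> foldr (\<otimes>) ws \<one>)) (b y) \<le> C * real (length ws)"
    if "y \<in> carrier G" "set ws \<subseteq> S" for y ws
    using that
  proof (induction ws arbitrary: y)
    case Nil
    then show ?case by (simp add: ip_dist_ell2 b_ell2)
  next
    case (Cons s ws)
    let ?w = "foldr (\<otimes>) ws \<one>"
    have [simp]: "s \<in> carrier G" "?w \<in> carrier G" "y \<in> carrier G" and s: "s \<in> S" "set ws \<subseteq> S"
      using Cons.prems SG by (auto intro!: foldr_mult_closed)
    have "ip_dist ell2 (b (y \<otimes> s \<otimes> ?w)) (b y) \<le>
        ip_dist ell2 (b (y \<otimes> s \<otimes> ?w)) (b (y \<otimes> s)) + ip_dist ell2 (b (y \<otimes> s)) (b y)"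
      by (intro H.ip_dist_triangle b_ell2) auto
    also have "\<dots> \<le> C * real (length ws) + C"
      using s by (intro add_mono Cons.IH step) auto
    finally show ?case by (simp add: m_assoc algebra_simps)
  qed
  show "\<exists>C>0. \<forall>x\<in>carrier G. \<forall>y\<in>carrier G.
         ip_dist ell2 (b x) (b y) \<le> C * real (word_length G S (inv y \<otimes> x)) + C"
  proof (intro exI[of _ C] conjI ballI \<open>C > 0\<close>)
    fix x y assume xy: "x \<in> carrier G" "y \<in> carrier G"
    then obtain ws where ws: "length ws = word_length G S (inv y \<otimes> x)" "set ws \<subseteq> S"
        "foldr (\<otimes>) ws \<one> = inv y \<otimes> x"
      using word_length_attained[OF S, of "inv y \<otimes> x"] by auto
    have "y \<otimes> (inv y \<otimes> x) = x" using xy by (simp add: m_assoc[symmetric])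
    then show "ip_dist ell2 (b x) (b y) \<le> C * real (word_length G S (inv y \<otimes> x)) + C"
      using word[OF xy(2) ws(2)] ws \<open>C > 0\<close> by simp
  qed
qed

end

section \<open>The averaging operator of the lazy walk\<close>

text \<open>
  Term by term in the power series, because \<open>2 ^ n * fact n \<le> fact (2 * n)\<close>.
\<close>

lemma cosh_le_exp_half_square: "cosh x \<le> exp (x\<^sup>2 / 2)" for x :: real
proof (rule sums_le)
  have "(\<lambda>n. if even (2 * n) then x ^ (2 * n) /\<^sub>R fact (2 * n) else 0) sums cosh x"
    using cosh_converges[of x]
    by (subst sums_mono_reindex[of "\<lambda>n. 2 * n" "\<lambda>n. if even n then x ^ n /\<^sub>R fact n else 0"])
       (auto simp: strict_mono_def elim!: evenE)
  then show "(\<lambda>n. (x\<^sup>2) ^ n / fact (2 * n)) sums cosh x"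
    by (simp add: divide_inverse_commute power_mult)
  show "(\<lambda>n. (x\<^sup>2 / 2) ^ n / fact n) sums exp (x\<^sup>2 / 2)"
    using exp_converges[of "x\<^sup>2 / 2"] by (simp only: divide_inverse_commute real_scaleR_def)
  have "2 ^ n * fact n \<le> (fact (2 * n) :: real)" for n
  proof (induction n)
    case (Suc n)
    have "2 ^ Suc n * fact (Suc n) = (2 * real n + 2) * (2 ^ n * fact n)"
      by (simp add: algebra_simps)
    also have "\<dots> \<le> (2 * real n + 2) * ((2 * real n + 1) * fact (2 * n))"
    proof (rule mult_left_mono)
      have "1 * (fact (2 * n) :: real) \<le> (2 * real n + 1) * fact (2 * n)"
        by (rule mult_right_mono) auto
      with Suc.IH show "2 ^ n * fact n \<le> (2 * real n + 1) * fact (2 * n)" by linarith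
    qed simp
    also have "\<dots> = fact (2 * Suc n)" by (simp add: algebra_simps)
    finally show ?case .
  qed simp
  then show "(x\<^sup>2) ^ n / fact (2 * n) \<le> (x\<^sup>2 / 2) ^ n / fact n" for n
    by (simp add: power_divide frac_le)
qed

text \<open>
  The walk steps by left multiplication, hence commutes with right translations, which will be the
  isometries of the embedding.  All functions on which its step operator acts are finitely
  supported, and sums over the group are written as unordered infinite sums so that they can be
  reindexed freely.
\<close>

locale lazy_walk = group G for G (structure) +
  fixes S :: "'a set"
  assumes S: "finite_symmetric_generating_set G S" and S_nonempty: "S \<noteq> {}"
begin

abbreviation len :: "'a \<Rightarrow> real" where
  "len g \<equiv> real (word_length G S g)"

abbreviation p :: "nat \<Rightarrow> 'a \<Rightarrow> real" where
  "p n \<equiv> convolution_power G (lazy_step G S) n"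

definition finsupp :: "('a \<Rightarrow> real) \<Rightarrow> bool" where
  "finsupp f \<longleftrightarrow> finite {x \<in> carrier G. f x \<noteq> 0}"

abbreviation gsum :: "('a \<Rightarrow> real) \<Rightarrow> real" where
  "gsum f \<equiv> \<Sum>\<^sub>\<infinity>x\<in>carrier G. f x"

text \<open>
  The step operator of the lazy walk, written as a mean of the half sums \<open>(f x + f (s x)) / 2\<close>: this
  is the form in which convexity of the square uses the laziness.
\<close>

definition avg :: "('a \<Rightarrow> real) \<Rightarrow> 'a \<Rightarrow> real" where
  "avg f x = (\<Sum>s\<in>S. (f x + f (s \<otimes> x)) / 2) / real (card S)"

lemma avg_eq: "avg f x = (\<Sum>s\<in>S. f x + f (s \<otimes> x)) / (2 * card S)"
  by (simp add: avg_def flip: sum_divide_distrib)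

lemma finite_S [simp]: "finite S" and S_carrier [simp]: "s \<in> S \<Longrightarrow> s \<in> carrier G"
  and inv_S [simp]: "s \<in> S \<Longrightarrow> inv s \<in> S"
  using S by (auto simp: finite_symmetric_generating_set_def)

declare S_nonempty [simp]

lemma card_S_pos [simp]: "0 < card S"
  using S_nonempty by (simp add: card_gt_0_iff)

lemma sum_S_inv: "(\<Sum>s\<in>S. F (inv s)) = (\<Sum>s\<in>S. F s)"
  by (rule sum.reindex_bij_witness[where i = "m_inv G" and j = "m_inv G"]) auto

lemma finsupp_summable: "finsupp f \<Longrightarrow> f summable_on carrier G"
  unfolding finsupp_def by (rule finite_nonzero_values_imp_summable_on)

lemma finsupp_subset: "\<lbrakk>finsupp f; \<And>x. \<lbrakk>x \<in> carrier G; f x = 0\<rbrakk> \<Longrightarrow> h x = 0\<rbrakk> \<Longrightarrow> finsupp h"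
  unfolding finsupp_def by (erule rev_finite_subset) auto

lemma finsupp_mult: "finsupp f \<Longrightarrow> finsupp (\<lambda>x. f x * h x)"
  and finsupp_mult': "finsupp f \<Longrightarrow> finsupp (\<lambda>x. h x * f x)"
  and finsupp_power: "\<lbrakk>finsupp f; 0 < k\<rbrakk> \<Longrightarrow> finsupp (\<lambda>x. f x ^ k)"
  and finsupp_divide: "finsupp f \<Longrightarrow> finsupp (\<lambda>x. f x / c)"
  by (erule finsupp_subset, simp)+

lemma finsupp_add: "\<lbrakk>finsupp f; finsupp h\<rbrakk> \<Longrightarrow> finsupp (\<lambda>x. f x + h x)"
  and finsupp_diff: "\<lbrakk>finsupp f; finsupp h\<rbrakk> \<Longrightarrow> finsupp (\<lambda>x. f x - h x)"
  unfolding finsupp_def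
  by (rule finite_subset[of _ "{x \<in> carrier G. f x \<noteq> 0} \<union> {x \<in> carrier G. h x \<noteq> 0}"]; auto)+

lemma finsupp_sum: "(\<And>s. s \<in> T \<Longrightarrow> finsupp (F s)) \<Longrightarrow> finsupp (\<lambda>x. \<Sum>s\<in>T. F s x)"
proof (induction T rule: infinite_finite_induct)
  case (insert s T)
  then have "finsupp (\<lambda>x. F s x + (\<Sum>s\<in>T. F s x))" by (intro finsupp_add) auto
  with insert show ?case by simp
qed (simp_all add: finsupp_def)

lemma bij_left: "s \<in> carrier G \<Longrightarrow> bij_betw (\<lambda>x. s \<otimes> x) (carrier G) (carrier G)"
  by (rule bij_betw_byWitness[where f' = "\<lambda>x. inv s \<otimes> x"]) (auto simp: m_assoc[symmetric])

lemma bij_right: "g \<in> carrier G \<Longrightarrow> bij_betw (\<lambda>x. x \<otimes> g) (carrier G) (carrier G)"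
  by (rule bij_betw_byWitness[where f' = "\<lambda>x. x \<otimes> inv g"]) (auto simp: m_assoc)

lemma finsupp_reindex:
  assumes "bij_betw \<beta> (carrier G) (carrier G)" "finsupp f"
  shows "finsupp (\<lambda>x. f (\<beta> x))"
proof -
  have "finite (\<beta> -` {x \<in> carrier G. f x \<noteq> 0} \<inter> carrier G)"
    using assms by (intro finite_vimage_IntI) (auto simp: bij_betw_def finsupp_def)
  moreover have "\<beta> -` {x \<in> carrier G. f x \<noteq> 0} \<inter> carrier G = {x \<in> carrier G. f (\<beta> x) \<noteq> 0}"
    using assms(1) by (auto simp: bij_betw_def)
  ultimately show ?thesis by (simp add: finsupp_def)
qed

lemmas finsupp_left = finsupp_reindex[OF bij_left]
lemmas finsupp_right = finsupp_reindex[OF bij_right]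

lemma gsum_left: "s \<in> carrier G \<Longrightarrow> gsum (\<lambda>x. f (s \<otimes> x)) = gsum f"
  by (rule infsum_reindex_bij_betw[OF bij_left])

lemma gsum_right: "g \<in> carrier G \<Longrightarrow> gsum (\<lambda>x. f (x \<otimes> g)) = gsum f"
  by (rule infsum_reindex_bij_betw[OF bij_right])

lemma gsum_add: "\<lbrakk>finsupp f; finsupp h\<rbrakk> \<Longrightarrow> gsum (\<lambda>x. f x + h x) = gsum f + gsum h"
  by (simp add: infsum_add finsupp_summable)

lemma gsum_sum:
  "(\<And>s. s \<in> T \<Longrightarrow> finsupp (F s)) \<Longrightarrow> gsum (\<lambda>x. \<Sum>s\<in>T. F s x) = (\<Sum>s\<in>T. gsum (F s))"
  by (induction T rule: infinite_finite_induct) (auto simp: gsum_add finsupp_sum)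

lemma gsum_mono:
  "\<lbrakk>finsupp f; finsupp h; \<And>x. x \<in> carrier G \<Longrightarrow> f x \<le> h x\<rbrakk> \<Longrightarrow> gsum f \<le> gsum h"
  by (simp add: infsum_mono finsupp_summable)

lemma gsum_divide: "gsum (\<lambda>x. f x / c) = gsum f / c"
  by (simp add: divide_inverse infsum_cmult_left')

lemma gsum_Cauchy_Schwarz:
  assumes f: "finsupp f" and h: "finsupp h"
  shows "(gsum (\<lambda>x. f x * h x))\<^sup>2 \<le> gsum (\<lambda>x. (f x)\<^sup>2) * gsum (\<lambda>x. (h x)\<^sup>2)"
proof -
  define F where "F = {x \<in> carrier G. f x \<noteq> 0} \<union> {x \<in> carrier G. h x \<noteq> 0}"
  have "finite F" using f h by (simp add: F_def finsupp_def)
  have "gsum u = sum u F" if "\<And>x. x \<in> carrier G - F \<Longrightarrow> u x = 0" for u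
  proof -
    have "gsum u = infsum u F"
      using that by (intro infsum_cong_neutral) (auto simp: F_def)
    then show ?thesis using \<open>finite F\<close> by simp
  qed
  then have "gsum (\<lambda>x. f x * h x) = (\<Sum>x\<in>F. f x * h x)"
    "gsum (\<lambda>x. (f x)\<^sup>2) = (\<Sum>x\<in>F. (f x)\<^sup>2)" "gsum (\<lambda>x. (h x)\<^sup>2) = (\<Sum>x\<in>F. (h x)\<^sup>2)"
    by (auto simp: F_def)
  then show ?thesis by (simp add: Cauchy_Schwarz_ineq_sum)
qed

lemma finsupp_avg: "finsupp f \<Longrightarrow> finsupp (avg f)"
  unfolding avg_def by (intro finsupp_divide finsupp_sum finsupp_add finsupp_left) auto

lemma avg_right: "\<lbrakk>x \<in> carrier G; g \<in> carrier G\<rbrakk> \<Longrightarrow> avg (\<lambda>z. f (z \<otimes> g)) x = avg f (x \<otimes> g)"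
  unfolding avg_def by (simp add: m_assoc)

lemma avg_self_adjoint:
  assumes f: "finsupp f" and h: "finsupp h"
  shows "gsum (\<lambda>x. avg f x * h x) = gsum (\<lambda>x. f x * avg h x)"
proof -
  have left: "gsum (\<lambda>x. avg f x * h x) =
      (\<Sum>s\<in>S. (gsum (\<lambda>x. f x * h x) + gsum (\<lambda>x. f (s \<otimes> x) * h x)) / 2) / card S"
    if "finsupp f" "finsupp h" for f h
  proof -
    have "gsum (\<lambda>x. avg f x * h x) =
        gsum (\<lambda>x. (\<Sum>s\<in>S. (f x * h x + f (s \<otimes> x) * h x) / 2) / card S)"
      by (simp add: avg_def sum_distrib_right add_divide_distrib distrib_right)
    also have "\<dots> = (\<Sum>s\<in>S. gsum (\<lambda>x. (f x * h x + f (s \<otimes> x) * h x) / 2)) / card S"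
      using that
      by (subst gsum_divide, subst gsum_sum)
        (auto intro!: finsupp_divide finsupp_add finsupp_mult finsupp_left)
    also have "(\<Sum>s\<in>S. gsum (\<lambda>x. (f x * h x + f (s \<otimes> x) * h x) / 2)) =
        (\<Sum>s\<in>S. (gsum (\<lambda>x. f x * h x) + gsum (\<lambda>x. f (s \<otimes> x) * h x)) / 2)"
      using that
      by (intro sum.cong refl) (simp add: gsum_divide gsum_add finsupp_mult finsupp_left)
    finally show ?thesis .
  qed
  have shift: "gsum (\<lambda>x. f (s \<otimes> x) * h x) = gsum (\<lambda>x. h (inv s \<otimes> x) * f x)" if "s \<in> S" for s
  proof -
    have "gsum (\<lambda>x. f (s \<otimes> x) * h (inv s \<otimes> (s \<otimes> x))) = gsum (\<lambda>x. f x * h (inv s \<otimes> x))"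
      using that by (intro gsum_left[of s "\<lambda>x. f x * h (inv s \<otimes> x)"]) simp
    moreover have "gsum (\<lambda>x. f (s \<otimes> x) * h (inv s \<otimes> (s \<otimes> x))) = gsum (\<lambda>x. f (s \<otimes> x) * h x)"
      using that by (intro infsum_cong) (simp add: m_assoc[symmetric])
    ultimately show ?thesis by (simp add: mult.commute)
  qed
  have comm: "gsum (\<lambda>x. f x * h x) = gsum (\<lambda>x. h x * f x)"
    by (simp add: mult.commute)
  have "(\<Sum>s\<in>S. (gsum (\<lambda>x. f x * h x) + gsum (\<lambda>x. f (s \<otimes> x) * h x)) / 2) =
      (\<Sum>s\<in>S. (gsum (\<lambda>x. h x * f x) + gsum (\<lambda>x. h (inv s \<otimes> x) * f x)) / 2)"
    by (intro sum.cong refl) (simp add: shift comm)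
  also have "\<dots> = (\<Sum>s\<in>S. (gsum (\<lambda>x. h x * f x) + gsum (\<lambda>x. h (s \<otimes> x) * f x)) / 2)"
    by (rule sum_S_inv)
  finally show ?thesis
    using left[OF f h] left[OF h f] by (simp add: mult.commute)
qed

text \<open>
  Convexity of the square, applied to the mean over the generators of the half sums.
\<close>

lemma weighted_avg_Jensen:
  assumes f: "finsupp f" and w: "\<And>x. x \<in> carrier G \<Longrightarrow> 0 \<le> w x"
  shows "gsum (\<lambda>x. w x * (avg f x)\<^sup>2) \<le>
    (\<Sum>s\<in>S. gsum (\<lambda>x. w x * (f x + f (s \<otimes> x))\<^sup>2)) / (4 * card S)"
proof -
  have fin: "finsupp (\<lambda>x. w x * (f x + f (s \<otimes> x))\<^sup>2)" if "s \<in> S" for s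
    using f that by (intro finsupp_mult' finsupp_power finsupp_add finsupp_left) auto
  have "(avg f x)\<^sup>2 \<le> (\<Sum>s\<in>S. (f x + f (s \<otimes> x))\<^sup>2) / (4 * card S)" for x
  proof -
    have "(\<Sum>s\<in>S. f x + f (s \<otimes> x))\<^sup>2 \<le> (\<Sum>s\<in>S. (f x + f (s \<otimes> x))\<^sup>2) * card S"
      by (rule sum_squared_le_sum_of_squares)
    then have "(\<Sum>s\<in>S. f x + f (s \<otimes> x))\<^sup>2 / (4 * (card S)\<^sup>2) \<le>
        (\<Sum>s\<in>S. (f x + f (s \<otimes> x))\<^sup>2) * card S / (4 * (card S)\<^sup>2)"
      by (rule divide_right_mono) simp
    then show ?thesis
      by (simp add: avg_eq power_divide power_mult_distrib) (simp add: power2_eq_square)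
  qed
  then have "w x * (avg f x)\<^sup>2 \<le> w x * ((\<Sum>s\<in>S. (f x + f (s \<otimes> x))\<^sup>2) / (4 * card S))"
    if "x \<in> carrier G" for x
    using w[OF that] by (intro mult_left_mono) auto
  then have "gsum (\<lambda>x. w x * (avg f x)\<^sup>2) \<le>
      gsum (\<lambda>x. (\<Sum>s\<in>S. w x * (f x + f (s \<otimes> x))\<^sup>2) / (4 * card S))"
    using f
    by (intro gsum_mono finsupp_mult'[of "\<lambda>x. (avg f x)\<^sup>2"] finsupp_divide finsupp_sum fin)
      (auto simp: sum_distrib_left intro!: finsupp_power finsupp_avg)
  also have "\<dots> = (\<Sum>s\<in>S. gsum (\<lambda>x. w x * (f x + f (s \<otimes> x))\<^sup>2)) / (4 * card S)"
    unfolding gsum_divide using fin by (subst gsum_sum) auto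
  finally show ?thesis .
qed

text \<open>
  The step operator is nearly a contraction in a weighted norm if the weight varies slowly along
  edges.  After the convexity estimate, the edge from \<open>x\<close> to \<open>s x\<close> and its reverse are added up: this
  turns the factor \<open>w x\<close> into \<open>w x + w (s x)\<close>, and the Cauchy--Schwarz inequality
  \<open>(a + b)\<^sup>2 \<le> (u a\<^sup>2 + v b\<^sup>2) (1 / u + 1 / v)\<close> with \<open>u = w x\<close> and \<open>v = w (s x)\<close> brings the weights back.
  If the weight changes little along edges, \<open>\<kappa>\<close> can be taken close to \<open>1\<close> with an error of second
  order only, since \<open>(u + v) (1 / u + 1 / v) = 4 + (u - v)\<^sup>2 / (u v)\<close>.  Without laziness the error is of
  first order already for a single edge.
\<close>

theorem weighted_avg_bound:
  assumes f: "finsupp f" and w: "\<And>x. x \<in> carrier G \<Longrightarrow> 0 < w x"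
    and ratio: "\<And>s x. \<lbrakk>s \<in> S; x \<in> carrier G\<rbrakk> \<Longrightarrow>
      (w x + w (s \<otimes> x)) * (1 / w x + 1 / w (s \<otimes> x)) \<le> 4 * \<kappa>"
  shows "gsum (\<lambda>x. w x * (avg f x)\<^sup>2) \<le> \<kappa> * gsum (\<lambda>x. w x * (f x)\<^sup>2)"
proof -
  define T where "T = gsum (\<lambda>x. w x * (f x)\<^sup>2)"
  define Q where "Q s = gsum (\<lambda>x. w x * (f x + f (s \<otimes> x))\<^sup>2)" for s
  define Q' where "Q' s = gsum (\<lambda>x. w (s \<otimes> x) * (f x + f (s \<otimes> x))\<^sup>2)" for s
  have fin: "finsupp (\<lambda>x. u x * (f x + f (s \<otimes> x))\<^sup>2)" "finsupp (\<lambda>x. u x * (f x)\<^sup>2)"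
    "finsupp (\<lambda>x. u x * (f (s \<otimes> x))\<^sup>2)" if "s \<in> S" for s u
    using f that by (auto intro!: finsupp_mult' finsupp_power finsupp_add finsupp_left)
  \<comment> \<open>Reversal of edges exchanges the two end points, of which \<open>Q\<close> and \<open>Q'\<close> carry the weight.\<close>
  have "Q' (inv s) = Q s" if "s \<in> S" for s
  proof -
    have "gsum (\<lambda>x. w (inv s \<otimes> x) * (f (s \<otimes> (inv s \<otimes> x)) + f (inv s \<otimes> x))\<^sup>2) =
        gsum (\<lambda>x. w x * (f (s \<otimes> x) + f x)\<^sup>2)"
      using that by (intro gsum_left[of "inv s" "\<lambda>x. w x * (f (s \<otimes> x) + f x)\<^sup>2"]) simp
    moreover have "Q' (inv s) = gsum (\<lambda>x. w (inv s \<otimes> x) * (f (s \<otimes> (inv s \<otimes> x)) + f (inv s \<otimes> x))\<^sup>2)"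
      unfolding Q'_def using that by (intro infsum_cong) (simp add: m_assoc[symmetric])
    ultimately show ?thesis by (simp add: Q_def add.commute)
  qed
  then have sym: "sum Q' S = sum Q S"
    using sum_S_inv[of Q'] by simp
  have QQ': "Q s + Q' s \<le> 8 * \<kappa> * T" if s: "s \<in> S" for s
  proof -
    have pw: "w x * (f x + f (s \<otimes> x))\<^sup>2 + w (s \<otimes> x) * (f x + f (s \<otimes> x))\<^sup>2 \<le>
        4 * \<kappa> * (w x * (f x)\<^sup>2) + 4 * \<kappa> * (w (s \<otimes> x) * (f (s \<otimes> x))\<^sup>2)"
      if x: "x \<in> carrier G" for x
    proof -
      define u v a b where "u = w x" and "v = w (s \<otimes> x)" and "a = f x" and "b = f (s \<otimes> x)"
      have uv: "u > 0" "v > 0" using w x s by (simp_all add: u_def v_def)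
      have "(u * a\<^sup>2 + v * b\<^sup>2) * (1 / u + 1 / v) - (a + b)\<^sup>2 = (u * a - v * b)\<^sup>2 / (u * v)"
        using uv by (simp add: field_simps power2_eq_square)
      also have "\<dots> \<ge> 0" using uv by simp
      finally have "(u + v) * (a + b)\<^sup>2 \<le> (u + v) * ((u * a\<^sup>2 + v * b\<^sup>2) * (1 / u + 1 / v))"
        using uv by (intro mult_left_mono) auto
      also have "\<dots> = (u + v) * (1 / u + 1 / v) * (u * a\<^sup>2 + v * b\<^sup>2)" by (simp add: mult_ac)
      also have "\<dots> \<le> 4 * \<kappa> * (u * a\<^sup>2 + v * b\<^sup>2)"
        using ratio[OF s x] uv by (intro mult_right_mono) (auto simp: u_def v_def)
      finally show ?thesis by (simp add: u_def v_def a_def b_def algebra_simps)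
    qed
    have "Q s + Q' s =
        gsum (\<lambda>x. w x * (f x + f (s \<otimes> x))\<^sup>2 + w (s \<otimes> x) * (f x + f (s \<otimes> x))\<^sup>2)"
      using fin[OF s] by (simp add: Q_def Q'_def gsum_add)
    also have "\<dots> \<le> gsum (\<lambda>x. 4 * \<kappa> * (w x * (f x)\<^sup>2) + 4 * \<kappa> * (w (s \<otimes> x) * (f (s \<otimes> x))\<^sup>2))"
      using pw by (intro gsum_mono finsupp_add fin[OF s] finsupp_mult'[of _ "\<lambda>_. 4 * \<kappa>"])
    also have "\<dots> = 4 * \<kappa> * T + 4 * \<kappa> * gsum (\<lambda>x. w (s \<otimes> x) * (f (s \<otimes> x))\<^sup>2)"
      using fin[OF s]
      by (subst gsum_add) (auto intro!: finsupp_mult'[of _ "\<lambda>_. 4 * \<kappa>"] simp: T_def infsum_cmult_right')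
    also have "gsum (\<lambda>x. w (s \<otimes> x) * (f (s \<otimes> x))\<^sup>2) = T"
      unfolding T_def using s by (intro gsum_left[of s "\<lambda>x. w x * (f x)\<^sup>2"]) simp
    finally show ?thesis by (simp add: mult_ac)
  qed
  have "2 * sum Q S = (\<Sum>s\<in>S. Q s + Q' s)"
    by (simp add: sum.distrib sym)
  also have "\<dots> \<le> (\<Sum>s\<in>S. 8 * \<kappa> * T)"
    by (intro sum_mono QQ')
  finally have "sum Q S / (4 * card S) \<le> \<kappa> * T"
    by (simp add: field_simps)
  moreover have "gsum (\<lambda>x. w x * (avg f x)\<^sup>2) \<le> sum Q S / (4 * card S)"
    unfolding Q_def by (intro weighted_avg_Jensen f less_imp_le w)
  ultimately show ?thesis by (simp add: T_def)
qed

text \<open>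
  In operator terms this is \<open>A\<^sup>2 \<le> A\<close> for the step operator \<open>A\<close>.  The upper bound in the convexity
  estimate for the constant weight \<open>1\<close> is exactly the inner product of \<open>A f\<close> with \<open>f\<close>.
\<close>

lemma avg_energy:
  assumes f: "finsupp f"
  shows "gsum (\<lambda>x. (avg f x)\<^sup>2) \<le> gsum (\<lambda>x. avg f x * f x)"
proof -
  have fin: "finsupp (\<lambda>x. (f x)\<^sup>2)" "finsupp (\<lambda>x. (f (s \<otimes> x))\<^sup>2)"
    "finsupp (\<lambda>x. 2 * (f (s \<otimes> x) * f x))" "finsupp (\<lambda>x. f (s \<otimes> x) * f x)"
    if "s \<in> S" for s
    using f finsupp_left[of s f] that by (simp_all add: finsupp_mult finsupp_mult' finsupp_power)
  have eq: "gsum (\<lambda>x. (f x + f (s \<otimes> x))\<^sup>2) = 2 * gsum (\<lambda>x. (f x)\<^sup>2 + f (s \<otimes> x) * f x)"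
    if s: "s \<in> S" for s
  proof -
    have "gsum (\<lambda>x. (f x + f (s \<otimes> x))\<^sup>2) =
        gsum (\<lambda>x. (f x)\<^sup>2 + (2 * (f (s \<otimes> x) * f x) + (f (s \<otimes> x))\<^sup>2))"
      by (simp add: power2_sum algebra_simps)
    also have "\<dots> = gsum (\<lambda>x. (f x)\<^sup>2) + (2 * gsum (\<lambda>x. f (s \<otimes> x) * f x) +
        gsum (\<lambda>x. (f (s \<otimes> x))\<^sup>2))"
      using fin[OF s] by (simp add: gsum_add finsupp_add infsum_cmult_right')
    also have "gsum (\<lambda>x. (f (s \<otimes> x))\<^sup>2) = gsum (\<lambda>x. (f x)\<^sup>2)"
      using s by (intro gsum_left[of s "\<lambda>x. (f x)\<^sup>2"]) simp
    finally show ?thesis using fin[OF s] by (simp add: gsum_add)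
  qed
  have "gsum (\<lambda>x. avg f x * f x) = gsum (\<lambda>x. (\<Sum>s\<in>S. ((f x)\<^sup>2 + f (s \<otimes> x) * f x) / 2) / card S)"
    by (simp add: avg_def sum_distrib_right add_divide_distrib distrib_right power2_eq_square)
  also have "\<dots> = (\<Sum>s\<in>S. gsum (\<lambda>x. (f x)\<^sup>2 + f (s \<otimes> x) * f x) / 2) / card S"
    using fin by (subst gsum_divide, subst gsum_sum) (simp_all add: gsum_divide finsupp_divide finsupp_add)
  also have "\<dots> = (\<Sum>s\<in>S. gsum (\<lambda>x. 1 * (f x + f (s \<otimes> x))\<^sup>2)) / (4 * card S)"
    by (simp add: eq flip: sum_divide_distrib sum_distrib_left)
  finally show ?thesis
    using weighted_avg_Jensen[OF f, of "\<lambda>_. 1"] by simp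
qed

section \<open>Return probabilities and Gaussian off-diagonal decay\<close>

lemma convolution_lazy_step:
  assumes x: "x \<in> carrier G"
  shows "convolution G (lazy_step G S) f x = avg f x"
proof -
  let ?F = "\<lambda>h. f (inv h \<otimes> x)" and ?T = "insert \<one> S"
  have "convolution G (lazy_step G S) f x = infsum (\<lambda>h. lazy_step G S h * ?F h) ?T"
    unfolding convolution_def by (rule infsum_cong_neutral) (auto simp: lazy_step_def)
  also have "\<dots> = (\<Sum>h\<in>?T. indicator {\<one>} h * ?F h / 2 + indicator S h * ?F h / (2 * card S))"
    by (simp add: lazy_step_def add_divide_distrib distrib_right mult.commute[of "real (card S)"])
  also have "\<dots> = (\<Sum>h\<in>?T. indicator {\<one>} h * ?F h) / 2 +
      (\<Sum>h\<in>?T. indicator S h * ?F h) / (2 * card S)"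
    by (simp only: sum.distrib sum_divide_distrib)
  also have "(\<Sum>h\<in>?T. indicator {\<one>} h * ?F h) = (\<Sum>h\<in>{\<one>}. ?F h)"
    by (rule sum.mono_neutral_cong_right) auto
  also have "(\<Sum>h\<in>?T. indicator S h * ?F h) = (\<Sum>h\<in>S. ?F h)"
    by (rule sum.mono_neutral_cong_right) auto
  also have "(\<Sum>h\<in>S. ?F h) = (\<Sum>s\<in>S. f (s \<otimes> x))"
    by (rule sum_S_inv[of "\<lambda>s. f (s \<otimes> x)"])
  finally show ?thesis
    using x by (simp add: avg_eq sum.distrib add_divide_distrib)
qed

lemma p_Suc: "x \<in> carrier G \<Longrightarrow> p (Suc n) x = avg (p n) x"
  by (simp add: convolution_lazy_step)

declare convolution_power.simps(2) [simp del]

lemma finsupp_p [simp]: "finsupp (p n)"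
proof (induction n)
  case 0
  show ?case by (simp add: finsupp_def indicator_def)
next
  case (Suc n)
  then have "finsupp (avg (p n))" by (rule finsupp_avg)
  then show ?case by (rule finsupp_subset) (simp add: p_Suc)
qed

lemma p_right_Suc:
  "\<lbrakk>x \<in> carrier G; g \<in> carrier G\<rbrakk> \<Longrightarrow> p (Suc n) (x \<otimes> g) = avg (\<lambda>z. p n (z \<otimes> g)) x"
  by (simp add: p_Suc avg_right)

text \<open>
  The step operator is self-adjoint and commutes with right translations, so all steps of the first
  factor can be moved to the second one, until the first is a point mass at \<open>inv x\<close>.
\<close>

theorem gsum_p_p:
  assumes "x \<in> carrier G" "y \<in> carrier G"
  shows "gsum (\<lambda>z. p m (z \<otimes> x) * p n (z \<otimes> y)) = p (m + n) (inv x \<otimes> y)"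
proof (induction m arbitrary: n)
  case 0
  have "gsum (\<lambda>z. p 0 (z \<otimes> x) * p n (z \<otimes> y)) = infsum (\<lambda>z. p n (z \<otimes> y)) {inv x}"
  proof (rule infsum_cong_neutral)
    fix z assume "z \<in> carrier G - {inv x}"
    then have "z \<otimes> x \<noteq> \<one>" using assms inv_equality by fastforce
    then show "p 0 (z \<otimes> x) * p n (z \<otimes> y) = 0" by simp
  qed (use assms in auto)
  then show ?case by simp
next
  case (Suc m)
  have fin: "finsupp (\<lambda>z. p k (z \<otimes> g))" if "g \<in> carrier G" for k g
    using that by (intro finsupp_right) auto
  have "gsum (\<lambda>z. p (Suc m) (z \<otimes> x) * p n (z \<otimes> y)) =
      gsum (\<lambda>z. avg (\<lambda>z. p m (z \<otimes> x)) z * p n (z \<otimes> y))"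
    using assms by (intro infsum_cong) (simp add: p_right_Suc)
  also have "\<dots> = gsum (\<lambda>z. p m (z \<otimes> x) * avg (\<lambda>z. p n (z \<otimes> y)) z)"
    using assms by (intro avg_self_adjoint fin)
  also have "\<dots> = gsum (\<lambda>z. p m (z \<otimes> x) * p (Suc n) (z \<otimes> y))"
    using assms by (intro infsum_cong) (simp add: p_right_Suc)
  also have "\<dots> = p (Suc m + n) (inv x \<otimes> y)"
    by (simp add: Suc.IH)
  finally show ?case .
qed

lemma gsum_p_square: "gsum (\<lambda>z. (p n z)\<^sup>2) = p (2 * n) \<one>"
proof -
  have "gsum (\<lambda>z. (p n z)\<^sup>2) = gsum (\<lambda>z. p n (z \<otimes> \<one>) * p n (z \<otimes> \<one>))"
    by (intro infsum_cong) (simp add: power2_eq_square)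
  then show ?thesis by (simp only: gsum_p_p[OF one_closed one_closed]) (simp add: mult_2)
qed

text \<open>
  Cauchy--Schwarz for the inner product of \<open>p n\<close> and \<open>p (n + 2)\<close>.
\<close>

lemma p_even_log_convex: "(p (2 * (n + 1)) \<one>)\<^sup>2 \<le> p (2 * n) \<one> * p (2 * (n + 2)) \<one>"
proof -
  have "gsum (\<lambda>z. p n z * p (n + 2) z) = gsum (\<lambda>z. p n (z \<otimes> \<one>) * p (n + 2) (z \<otimes> \<one>))"
    by (intro infsum_cong) simp
  also have "\<dots> = p (2 * (n + 1)) \<one>"
    unfolding gsum_p_p[OF one_closed one_closed] by (simp add: mult_2)
  finally show ?thesis
    using gsum_Cauchy_Schwarz[of "p n" "p (n + 2)"] by (simp only: gsum_p_square finsupp_p)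
qed

lemma p_even_le_odd: "p (2 * (n + 1)) \<one> \<le> p (2 * n + 1) \<one>"
proof -
  have "gsum (\<lambda>z. avg (p n) z * p n z) = gsum (\<lambda>z. p (n + 1) (z \<otimes> \<one>) * p n (z \<otimes> \<one>))"
    by (intro infsum_cong) (simp add: p_Suc)
  also have "\<dots> = p (2 * n + 1) \<one>"
    unfolding gsum_p_p[OF one_closed one_closed] by (simp add: mult_2)
  finally have "gsum (\<lambda>z. avg (p n) z * p n z) = p (2 * n + 1) \<one>" .
  moreover have "gsum (\<lambda>z. (avg (p n) z)\<^sup>2) = p (2 * (n + 1)) \<one>"
    unfolding gsum_p_square[symmetric] by (intro infsum_cong) (simp add: p_Suc)
  ultimately show ?thesis using avg_energy[of "p n"] by simp
qed

theorem weighted_p_bound: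
  assumes w: "\<And>x. x \<in> carrier G \<Longrightarrow> 0 < w x"
    and ratio: "\<And>s x. \<lbrakk>s \<in> S; x \<in> carrier G\<rbrakk> \<Longrightarrow>
      (w x + w (s \<otimes> x)) * (1 / w x + 1 / w (s \<otimes> x)) \<le> 4 * \<kappa>"
    and g: "g \<in> carrier G"
  shows "gsum (\<lambda>x. w x * (p n (x \<otimes> g))\<^sup>2) \<le> \<kappa> ^ n * w (inv g)"
proof (induction n)
  case 0
  have "gsum (\<lambda>x. w x * (p 0 (x \<otimes> g))\<^sup>2) = infsum w {inv g}"
  proof (rule infsum_cong_neutral)
    fix z assume "z \<in> carrier G - {inv g}"
    then have "z \<otimes> g \<noteq> \<one>" using g inv_equality by fastforce
    then show "w z * (p 0 (z \<otimes> g))\<^sup>2 = 0" by simp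
  qed (use g in auto)
  then show ?case by simp
next
  case (Suc n)
  obtain s where "s \<in> S" using S_nonempty by blast
  have "0 \<le> 4 * \<kappa>"
    using ratio[OF \<open>s \<in> S\<close> one_closed] w[of \<one>] w[of "s \<otimes> \<one>"] \<open>s \<in> S\<close>
    by (intro order_trans[OF _ ratio[OF \<open>s \<in> S\<close> one_closed]] mult_nonneg_nonneg add_nonneg_nonneg) auto
  have "gsum (\<lambda>x. w x * (p (Suc n) (x \<otimes> g))\<^sup>2) = gsum (\<lambda>x. w x * (avg (\<lambda>z. p n (z \<otimes> g)) x)\<^sup>2)"
    using g by (intro infsum_cong) (simp add: p_right_Suc)
  also have "\<dots> \<le> \<kappa> * gsum (\<lambda>x. w x * (p n (x \<otimes> g))\<^sup>2)"
    using g by (intro weighted_avg_bound finsupp_right w ratio) auto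
  also have "\<dots> \<le> \<kappa> * (\<kappa> ^ n * w (inv g))"
    using Suc.IH \<open>0 \<le> 4 * \<kappa>\<close> by (intro mult_left_mono) auto
  finally show ?case by (simp add: mult.assoc)
qed

lemma exponential_weight_ratio:
  assumes "s \<in> S" "x \<in> carrier G"
  shows "(exp (c * len x) + exp (c * len (s \<otimes> x))) *
    (1 / exp (c * len x) + 1 / exp (c * len (s \<otimes> x))) \<le> 4 * (cosh (c / 2))\<^sup>2"
proof -
  define d where "d = c * (len (s \<otimes> x) - len x)"
  have "\<bar>d\<bar> \<le> \<bar>c\<bar>"
    using word_length_generator_step[OF S assms] unfolding d_def abs_mult
    by (metis abs_ge_zero mult.right_neutral mult_left_mono)
  then have "cosh d \<le> cosh c"
    by (metis abs_ge_zero cosh_real_abs cosh_real_nonneg_le_iff)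
  have "(exp (c * len x) + exp (c * len (s \<otimes> x))) *
      (1 / exp (c * len x) + 1 / exp (c * len (s \<otimes> x))) = 2 + (exp d + exp (- d))"
    by (simp add: d_def field_simps exp_diff exp_minus)
  also have "\<dots> = 2 + 2 * cosh d" by (simp add: cosh_field_def)
  also have "\<dots> \<le> 2 + 2 * cosh (2 * (c / 2))" using \<open>cosh d \<le> cosh c\<close> by simp
  also have "\<dots> = 4 * (cosh (c / 2))\<^sup>2" unfolding cosh_double_cosh by simp
  finally show ?thesis .
qed

text \<open>
  Write \<open>p (2 * n) g\<close> as the inner product of \<open>p n\<close> with its translate by \<open>g\<close>, and insert the weight
  \<open>exp (\<theta> |z|)\<close> in one factor and its inverse in the other.  The squares of both weights change by at
  most the factor \<open>exp (2 \<bar>\<theta>\<bar>)\<close> along an edge, so each norm grows by at most \<open>cosh \<theta>\<close> per step.  The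
  first factor starts at the identity with weight \<open>1\<close>, the second at \<open>inv g\<close> with weight
  \<open>exp (- \<theta> |inv g|)\<close>, and this is the decay.
\<close>

lemma p_exponential_bound:
  assumes g: "g \<in> carrier G"
  shows "p (2 * n) g \<le> exp (\<theta>\<^sup>2 * n - \<theta> * len (inv g))"
proof -
  define \<kappa> where "\<kappa> = (cosh \<theta>)\<^sup>2"
  define w where "w c x = exp (c * len x)" for c x
  define u where "u c y z = exp (c / 2 * len z) * p n (z \<otimes> y)" for c y z
  have bound: "gsum (\<lambda>z. (u c y z)\<^sup>2) \<le> \<kappa> ^ n * w c (inv y)"
    if "c \<in> {2 * \<theta>, - 2 * \<theta>}" "y \<in> carrier G" for c y
  proof -
    have "(u c y z)\<^sup>2 = w c z * (p n (z \<otimes> y))\<^sup>2" for z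
      by (simp add: u_def w_def power_mult_distrib flip: exp_double)
    moreover have "(cosh (c / 2))\<^sup>2 = \<kappa>"
      using that(1) by (auto simp: \<kappa>_def)
    then have "gsum (\<lambda>z. w c z * (p n (z \<otimes> y))\<^sup>2) \<le> \<kappa> ^ n * w c (inv y)"
      using exponential_weight_ratio[of _ _ c] that(2)
      by (intro weighted_p_bound) (auto simp: w_def)
    ultimately show ?thesis by simp
  qed
  have fin: "finsupp (u c y)" if "y \<in> carrier G" for c y
    unfolding u_def using that by (intro finsupp_mult' finsupp_right) auto
  have "p (2 * n) g = gsum (\<lambda>z. p n (z \<otimes> \<one>) * p n (z \<otimes> g))"
    unfolding gsum_p_p[OF one_closed g] using g by (simp add: mult_2)
  also have "\<dots> = gsum (\<lambda>z. u (2 * \<theta>) \<one> z * u (- 2 * \<theta>) g z)"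
    by (intro infsum_cong) (simp add: u_def exp_minus)
  finally have "(p (2 * n) g)\<^sup>2 \<le>
      gsum (\<lambda>z. (u (2 * \<theta>) \<one> z)\<^sup>2) * gsum (\<lambda>z. (u (- 2 * \<theta>) g z)\<^sup>2)"
    using gsum_Cauchy_Schwarz[OF fin fin, of \<one> g] g by simp
  also have "\<dots> \<le> (\<kappa> ^ n * w (2 * \<theta>) (inv \<one>)) * (\<kappa> ^ n * w (- 2 * \<theta>) (inv g))"
    using g by (intro mult_mono bound) (auto intro!: infsum_nonneg simp: \<kappa>_def w_def)
  also have "\<dots> = (\<kappa> ^ n * exp (- \<theta> * len (inv g)))\<^sup>2"
    by (simp add: w_def power_mult_distrib power2_eq_square flip: exp_add)
  finally have "p (2 * n) g \<le> \<kappa> ^ n * exp (- \<theta> * len (inv g))"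
    by (rule power2_le_imp_le) (simp add: \<kappa>_def)
  also have "\<dots> \<le> exp (\<theta>\<^sup>2) ^ n * exp (- \<theta> * len (inv g))"
  proof (intro mult_right_mono power_mono)
    have "\<kappa> \<le> (exp (\<theta>\<^sup>2 / 2))\<^sup>2"
      unfolding \<kappa>_def by (intro power_mono cosh_le_exp_half_square) (simp add: cosh_real_nonneg)
    then show "\<kappa> \<le> exp (\<theta>\<^sup>2)" by (simp flip: exp_double)
  qed (simp_all add: \<kappa>_def)
  finally show ?thesis
    by (simp add: exp_diff exp_minus divide_inverse mult.commute flip: exp_of_nat_mult)
qed

text \<open>
  The choice \<open>\<theta> = |inv g| / (2 n)\<close> minimises the exponent of the preceding bound.
\<close>

theorem Varopoulos_Carne:
  assumes "g \<in> carrier G" "n > 0"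
  shows "p (2 * n) g \<le> exp (- (len (inv g))\<^sup>2 / (4 * n))"
proof -
  define \<theta> where "\<theta> = len (inv g) / (2 * n)"
  have "\<theta>\<^sup>2 * n - \<theta> * len (inv g) = - (len (inv g))\<^sup>2 / (4 * n)"
    using \<open>n > 0\<close> by (simp add: \<theta>_def field_simps power2_eq_square)
  then show ?thesis
    using p_exponential_bound[OF assms(1), of n \<theta>] by simp
qed

end

section \<open>Displacement of the densities of the walk\<close>

text \<open>
  The ratios \<open>b (n + 1) / b n\<close> increase, so their product up to \<open>n\<close>, which is \<open>b n\<close>, is at most the
  \<open>n\<close>-th power of the last one.  A slowly decaying sequence therefore has small relative
  decrements.
\<close>

lemma log_convex_decay_rate:
  fixes b :: "nat \<Rightarrow> real"
  assumes b0: "b 0 = 1" and pos: "\<And>n. 0 < b n"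
    and conv: "\<And>n. (b (n + 1))\<^sup>2 \<le> b n * b (n + 2)" and "n > 0"
  shows "1 - b (n + 1) / b n \<le> - ln (b n) / n"
proof -
  define r where "r k = b (k + 1) / b k" for k
  have r_pos: "0 < r k" for k using pos by (simp add: r_def)
  have "r k \<le> r (Suc k)" for k
    using conv[of k] pos[of k] pos[of "k + 1"] by (simp add: r_def field_simps power2_eq_square)
  then have r_mono: "r k \<le> r n" if "k \<le> n" for k
    using that by (rule lift_Suc_mono_le)
  have "b k \<le> r n ^ k" if "k \<le> n" for k
    using that
  proof (induction k)
    case (Suc k)
    have "b (Suc k) = r k * b k" using pos[of k] by (simp add: r_def)
    also have "\<dots> \<le> r n * r n ^ k"
      using Suc pos[of k] r_pos[of n] by (intro mult_mono r_mono) auto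
    finally show ?case by simp
  qed (simp add: b0)
  then have "ln (b n) \<le> ln (r n ^ n)"
    using pos[of n] r_pos[of n] by simp
  also have "\<dots> = n * ln (r n)" using r_pos by (simp add: ln_realpow)
  also have "\<dots> \<le> n * (r n - 1)"
    using r_pos ln_le_minus_one by (intro mult_left_mono) auto
  finally show ?thesis using \<open>n > 0\<close> by (simp add: r_def field_simps)
qed

context lazy_walk
begin

lemma p_displacement:
  assumes x: "x \<in> carrier G" and y: "y \<in> carrier G"
  shows "gsum (\<lambda>z. (p n (z \<otimes> x) - p n (z \<otimes> y))\<^sup>2) = 2 * (p (2 * n) \<one> - p (2 * n) (inv x \<otimes> y))"
proof -
  have fin: "finsupp (\<lambda>z. p n (z \<otimes> g) * p n (z \<otimes> h))" if "g \<in> carrier G" for g h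
    using that finsupp_right[of g "p n"] by (simp add: finsupp_mult)
  have "gsum (\<lambda>z. (p n (z \<otimes> x) - p n (z \<otimes> y))\<^sup>2) =
      gsum (\<lambda>z. (p n (z \<otimes> x) * p n (z \<otimes> x) + p n (z \<otimes> y) * p n (z \<otimes> y)) +
        (- 2) * (p n (z \<otimes> x) * p n (z \<otimes> y)))"
    by (simp add: power2_eq_square algebra_simps)
  also have "\<dots> = gsum (\<lambda>z. p n (z \<otimes> x) * p n (z \<otimes> x)) + gsum (\<lambda>z. p n (z \<otimes> y) * p n (z \<otimes> y)) +
      (- 2) * gsum (\<lambda>z. p n (z \<otimes> x) * p n (z \<otimes> y))"
    using x y fin
    by (simp only: gsum_add finsupp_add finsupp_mult'[of _ "\<lambda>_. - 2"] infsum_cmult_right')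
  also have "\<dots> = 2 * (p (2 * n) \<one> - p (2 * n) (inv x \<otimes> y))"
    using x y by (simp add: gsum_p_p flip: mult_2)
  finally show ?thesis .
qed

lemma p_even_le_one:
  assumes g: "g \<in> carrier G"
  shows "p (2 * n) g \<le> p (2 * n) \<one>"
proof -
  have "0 \<le> gsum (\<lambda>z. (p n (z \<otimes> \<one>) - p n (z \<otimes> g))\<^sup>2)" by (rule infsum_nonneg) simp
  then show ?thesis using g by (simp only: p_displacement[OF one_closed g]) simp
qed

text \<open>
  The sum of the left-hand side over all generators is a multiple of the decrement of the return
  probability in one step, because its value at time \<open>2 n + 1\<close> is a mean of values of \<open>p (2 n)\<close>; all
  summands are nonnegative.  The decrement in one step is at most that in two.
\<close>

lemma generator_displacement:
  assumes s: "s \<in> S"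
  shows "p (2 * n) \<one> - p (2 * n) s \<le> 2 * card S * (p (2 * n) \<one> - p (2 * (n + 1)) \<one>)"
proof -
  have "p (2 * n) \<one> - p (2 * n) s \<le> (\<Sum>s\<in>S. p (2 * n) \<one> - p (2 * n) s)"
    using s by (intro member_le_sum) (simp_all add: p_even_le_one)
  also have "\<dots> = 2 * card S * (p (2 * n) \<one> - p (2 * n + 1) \<one>)"
    using p_Suc[of \<one> "2 * n"]
    by (simp add: avg_eq sum.distrib sum_subtractf field_simps)
  also have "\<dots> \<le> 2 * card S * (p (2 * n) \<one> - p (2 * (n + 1)) \<one>)"
    using p_even_le_odd[of n] by (intro mult_left_mono) auto
  finally show ?thesis .
qed

end

section \<open>Compression from return probabilities\<close>

text \<open>
  The compression function is \<open>(t / D) powr c\<close> itself.  The case \<open>x = y\<close> of the lower bound is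
  harmless because \<open>0 powr c = 0\<close>.
\<close>

lemma (in group) compression_exponent_coboundary:
  fixes \<phi> :: "'i \<Rightarrow> real" and act :: "'a \<Rightarrow> 'i \<Rightarrow> 'i"
  assumes S: "finite_symmetric_generating_set G S"
    and act_one: "\<And>i. act \<one> i = i"
    and act_mult: "\<And>g h i. \<lbrakk>g \<in> carrier G; h \<in> carrier G\<rbrakk> \<Longrightarrow> act (g \<otimes> h) i = act h (act g i)"
    and gen: "\<And>s. s \<in> S \<Longrightarrow> (\<lambda>i. (\<phi> (act s i) - \<phi> i)\<^sup>2) summable_on UNIV"
    and D: "D > 0" and c: "0 < c" "c \<le> 1"
    and lower: "\<And>x y. \<lbrakk>x \<in> carrier G; y \<in> carrier G\<rbrakk> \<Longrightarrow>
      (real (word_length G S (inv y \<otimes> x)) / D) powr c \<le>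
      sqrt (\<Sum>\<^sub>\<infinity>i. (\<phi> (act x i) - \<phi> (act y i))\<^sup>2)"
  shows "c \<le> equivariant_compression_exponent G S"
proof -
  define b where "b g i = \<phi> (act g i) - \<phi> i" for g i
  define \<rho> where "\<rho> t = (t / D) powr c" for t
  note vc = S act_one act_mult gen
  have b_ell2: "b g \<in> carrier ell2" if "g \<in> carrier G" for g
    unfolding b_def using virtual_coboundary_ell2[OF vc that] .
  have \<rho>: "compression_function G S ell2 b \<rho>"
    unfolding compression_function_def
  proof (intro conjI allI impI ballI)
    show "mono_on {0..} \<rho>"
      unfolding \<rho>_def using D c by (intro mono_onI powr_mono2) (auto simp: divide_right_mono)
    show "\<not> bdd_above (\<rho> ` {0..})"
    proof
      assume "bdd_above (\<rho> ` {0..})"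
      then obtain B where B: "\<And>t. t \<ge> 0 \<Longrightarrow> \<rho> t \<le> B" by (auto simp: bdd_above_def)
      have "\<rho> (D * (\<bar>B\<bar> + 1) powr (1 / c)) = \<bar>B\<bar> + 1"
        using D c by (simp add: \<rho>_def powr_powr)
      then show False using B[of "D * (\<bar>B\<bar> + 1) powr (1 / c)"] D by simp
    qed
    show "\<rho> (word_length G S (inv y \<otimes> x)) \<le> ip_dist ell2 (b x) (b y)"
      if "x \<in> carrier G" "y \<in> carrier G" for x y
      using lower[OF that] that by (simp add: ip_dist_ell2 b_ell2) (simp add: b_def \<rho>_def)
  qed (simp add: \<rho>_def)
  have "equivariant_uniform_embedding G S ell2 b"
    unfolding equivariant_uniform_embedding_def
  proof (intro conjI)
    show "\<exists>\<pi>\<in>hom G (Isom ell2). \<forall>g\<in>carrier G. \<forall>x\<in>carrier G. b (g \<otimes> x) = \<pi> g (b x)"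
      unfolding b_def using virtual_coboundary_affine_action[OF vc] .
    show "\<exists>C>0. \<forall>x\<in>carrier G. \<forall>y\<in>carrier G.
        ip_dist ell2 (b x) (b y) \<le> C * real (word_length G S (inv y \<otimes> x)) + C"
      unfolding b_def using virtual_coboundary_Lipschitz[OF vc] .
  qed (use b_ell2 \<rho> in blast)+
  then have "compression_exponent G S ell2 b \<le> equivariant_compression_exponent G S"
    by (intro compression_exponent_le_equivariant is_group hilbert_ell2)
  moreover have "c \<le> compression_exponent G S ell2 b"
    unfolding compression_exponent_def
  proof (rule cSup_upper)
    have "\<forall>n::nat. n \<ge> 1 \<longrightarrow> \<rho> n \<ge> (1 / D) powr c * n powr c"
      using D by (simp add: \<rho>_def flip: powr_mult)
    then show "c \<in> insert 0 {c \<in> {0..1}. \<exists>K>0. \<exists>\<rho>. compression_function G S ell2 b \<rho> \<and>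
       (\<forall>n::nat. n \<ge> 1 \<longrightarrow> \<rho> (real n) \<ge> K * real n powr c)}"
      using c \<rho> D by (intro insertI2 CollectI conjI exI[of _ "(1 / D) powr c"] exI[of _ \<rho>]) auto
  qed (auto intro!: bdd_aboveI[of _ 1])
  ultimately show ?thesis by linarith
qed

text \<open>
  The virtual coboundary of \<open>\<phi> (n, z) = sqrt (a n) * p n z\<close> on countably many copies of the group.  The
  weight \<open>a n\<close> combines the normalisation \<open>1 / b n\<close> of the density \<open>p n\<close> with \<open>(n + 1) powr (\<theta> - 1)\<close>.  A
  generator moves the \<open>n\<close>-th normalised density by \<open>O (n powr (\<gamma> - 1))\<close> in squared norm, so it
  displaces the whole by a convergent sum as \<open>\<theta> + \<gamma> < 1\<close>.  An element \<open>g\<close> moves each of the first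
  \<open>(|g| / D) powr (2 / (1 + \<gamma>))\<close> normalised densities by at least \<open>1\<close> in squared norm, and the weights
  of these add up to \<open>(|g| / D) powr (2 * c)\<close> for \<open>\<theta> = c * (1 + \<gamma>)\<close>.
\<close>

theorem (in lazy_walk) compression_exponent_lower_bound:
  fixes L K \<gamma> c :: real
  assumes LK: "L > 0" "K > 0" and \<gamma>: "0 \<le> \<gamma>" "\<gamma> < 1"
    and return: "\<And>n. n \<ge> 1 \<Longrightarrow> p n \<one> \<ge> L * exp (- K * n powr \<gamma>)"
    and c: "0 < c" "c < (1 - \<gamma>) / (1 + \<gamma>)"
  shows "c \<le> equivariant_compression_exponent G S"
proof -
  define \<theta> where "\<theta> = c * (1 + \<gamma>)"
  have \<theta>: "0 < \<theta>" "\<theta> + \<gamma> < 1"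
    using c \<gamma> by (simp_all add: \<theta>_def pos_less_divide_eq)
  define b where "b n = p (2 * n) \<one>" for n
  have b_lower: "L * exp (- K * (2 * n) powr \<gamma>) \<le> b n" if "n > 0" for n
    using return[of "2 * n"] that by (simp add: b_def)
  have b0: "b 0 = 1" by (simp add: b_def)
  have b_pos: "0 < b n" for n
  proof (cases "n = 0")
    case False
    then show ?thesis using b_lower[of n] LK by (intro less_le_trans[OF _ b_lower]) auto
  qed (simp add: b0)
  have K_powr: "K * (2 * n) powr \<gamma> + m \<le> (K * 2 powr \<gamma> + \<bar>m\<bar>) * n powr \<gamma>"
    if "n > 0" for n :: nat and m
  proof -
    have "1 \<le> n powr \<gamma>" using that \<gamma> by (intro ge_one_powr_ge_zero) auto
    then have "m \<le> \<bar>m\<bar> * n powr \<gamma>"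
      using mult_left_mono[of 1 "n powr \<gamma>" "\<bar>m\<bar>"] by linarith
    then show ?thesis by (simp add: powr_mult algebra_simps)
  qed

  define a where "a n = (n + 1) powr (\<theta> - 1) / b n" for n :: nat
  have a_nonneg: "0 \<le> a n" for n using b_pos[of n] by (simp add: a_def)
  define \<phi> where "\<phi> = (\<lambda>(n, z). sqrt (a n) * p n z)"
  \<comment> \<open>Outside the carrier the action is trivial, so that no coordinate there contributes.\<close>
  define act where "act g = (\<lambda>(n::nat, z). (n, if z \<in> carrier G then z \<otimes> g else z))" for g
  define q where "q x y = (\<lambda>i. (\<phi> (act x i) - \<phi> (act y i))\<^sup>2)" for x y
  have act_one: "act \<one> i = i" for i by (cases i) (simp add: act_def)
  have act_mult: "act (g \<otimes> h) i = act h (act g i)" if "g \<in> carrier G" "h \<in> carrier G" for g h i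
    using that by (cases i) (simp add: act_def m_assoc)
  have q_eq: "q x y (n, z) = a n * (p n (z \<otimes> x) - p n (z \<otimes> y))\<^sup>2" if "z \<in> carrier G" for x y n z
    using that a_nonneg
    by (simp add: q_def \<phi>_def act_def power_mult_distrib flip: right_diff_distrib)
  have q_support: "z \<in> carrier G" if "q x y (n, z) \<noteq> 0" for x y n z
    using that by (auto simp: q_def \<phi>_def act_def split: if_splits)
  have fibre_summable: "(\<lambda>z. q x y (n, z)) summable_on carrier G"
    if "x \<in> carrier G" "y \<in> carrier G" for x y n
  proof -
    have "finsupp (\<lambda>z. a n * (p n (z \<otimes> x) - p n (z \<otimes> y))\<^sup>2)"
      using that finsupp_right[of x "p n"] finsupp_right[of y "p n"]
      by (simp add: finsupp_mult' finsupp_power finsupp_diff)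
    then show ?thesis
      by (rule finsupp_summable[THEN summable_on_cong[THEN iffD2, rotated]]) (simp add: q_eq)
  qed
  have fibre: "gsum (\<lambda>z. q x y (n, z)) = a n * (2 * (b n - p (2 * n) (inv x \<otimes> y)))"
    if "x \<in> carrier G" "y \<in> carrier G" for x y n
  proof -
    have "gsum (\<lambda>z. q x y (n, z)) = gsum (\<lambda>z. a n * (p n (z \<otimes> x) - p n (z \<otimes> y))\<^sup>2)"
      by (intro infsum_cong) (simp add: q_eq)
    then show ?thesis using that by (simp add: infsum_cmult_right' p_displacement b_def)
  qed

  have gen: "q s \<one> summable_on UNIV" if s: "s \<in> S" for s
  proof -
    define F where "F n = a n * (2 * (b n - p (2 * n) (inv s \<otimes> \<one>)))" for n
    have F_nonneg: "0 \<le> F n" for n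
      using s a_nonneg by (simp add: F_def b_def p_even_le_one)
    define C where "C = 4 * card S * (K * 2 powr \<gamma> + \<bar>- ln L\<bar>)"
    have F_le: "F n \<le> C * n powr (\<theta> + \<gamma> - 2)" if n: "n > 0" for n
    proof -
      have "1 - b (n + 1) / b n \<le> - ln (b n) / n"
        using p_even_log_convex n by (intro log_convex_decay_rate b0 b_pos) (simp add: b_def)
      also have "ln (L * exp (- K * (2 * n) powr \<gamma>)) \<le> ln (b n)"
        using b_lower[OF n] LK b_pos by (subst ln_le_cancel_iff) auto
      then have "- ln (b n) \<le> K * (2 * n) powr \<gamma> + (- ln L)"
        using LK by (simp add: ln_mult)
      then have "- ln (b n) \<le> (K * 2 powr \<gamma> + \<bar>- ln L\<bar>) * n powr \<gamma>"
        using K_powr[OF n, of "- ln L"] by linarith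
      then have "- ln (b n) / n \<le> (K * 2 powr \<gamma> + \<bar>- ln L\<bar>) * n powr \<gamma> / n"
        by (rule divide_right_mono) simp
      also have "\<dots> = (K * 2 powr \<gamma> + \<bar>- ln L\<bar>) * n powr (\<gamma> - 1)"
        using n by (simp add: powr_diff)
      finally have rate: "1 - b (n + 1) / b n \<le> (K * 2 powr \<gamma> + \<bar>- ln L\<bar>) * n powr (\<gamma> - 1)" .
      have "F n \<le> a n * (2 * (2 * card S * (b n - b (n + 1))))"
        unfolding F_def b_def using s a_nonneg generator_displacement[of "inv s" n]
        by (intro mult_left_mono) auto
      also have "\<dots> = 4 * card S * ((n + 1) powr (\<theta> - 1) * (1 - b (n + 1) / b n))"
        using b_pos[of n] by (simp add: a_def field_simps)
      also have "\<dots> \<le> 4 * card S * (n powr (\<theta> - 1) * ((K * 2 powr \<gamma> + \<bar>- ln L\<bar>) * n powr (\<gamma> - 1)))"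
      proof (rule mult_left_mono)
        have "(n + 1) powr (\<theta> - 1) * (1 - b (n + 1) / b n) \<le>
            (n + 1) powr (\<theta> - 1) * ((K * 2 powr \<gamma> + \<bar>- ln L\<bar>) * n powr (\<gamma> - 1))"
          using rate by (rule mult_left_mono) simp
        also have "\<dots> \<le> n powr (\<theta> - 1) * ((K * 2 powr \<gamma> + \<bar>- ln L\<bar>) * n powr (\<gamma> - 1))"
          using n \<theta> \<gamma> LK by (intro mult_right_mono powr_mono2') auto
        finally show "(n + 1) powr (\<theta> - 1) * (1 - b (n + 1) / b n) \<le>
            n powr (\<theta> - 1) * ((K * 2 powr \<gamma> + \<bar>- ln L\<bar>) * n powr (\<gamma> - 1))" .
      qed simp
      also have "\<dots> = C * (n powr (\<theta> - 1) * n powr (\<gamma> - 1))"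
        by (simp add: C_def)
      also have "n powr (\<theta> - 1) * n powr (\<gamma> - 1) = n powr (\<theta> + \<gamma> - 2)"
        by (simp flip: powr_add)
      finally show ?thesis .
    qed
    have "summable F"
    proof (rule summable_comparison_test_ev)
      show "\<forall>\<^sub>F n in sequentially. norm (F n) \<le> C * n powr (\<theta> + \<gamma> - 2)"
        using eventually_gt_at_top[of 0] by eventually_elim (use F_le F_nonneg in auto)
      show "summable (\<lambda>n. C * real n powr (\<theta> + \<gamma> - 2))"
        using \<theta> by (intro summable_mult) (simp add: summable_real_powr_iff)
    qed
    then have "F summable_on UNIV"
      using F_nonneg by (rule summable_nonneg_imp_summable_on)
    moreover have "((\<lambda>z. q s \<one> (n, z)) has_sum F n) (carrier G)" for n
      using fibre_summable[of s \<one> n] fibre[of s \<one> n] s by (simp add: has_sum_iff F_def)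
    ultimately have "q s \<one> summable_on (UNIV \<times> carrier G)"
      by (intro summable_on_SigmaI[where g = F]) (auto simp: q_def)
    then show ?thesis
      by (rule summable_on_cong_neutral[THEN iffD1, rotated -1]) (auto dest: q_support)
  qed
  then have gen': "(\<lambda>i. (\<phi> (act s i) - \<phi> i)\<^sup>2) summable_on UNIV" if "s \<in> S" for s
    using that by (simp add: q_def act_one)

  \<comment> \<open>The constant \<open>D\<close> makes the Gaussian bound for \<open>|g| \<ge> D n powr ((1 + \<gamma>) / 2)\<close> at most half the
     assumed lower bound for the return probability at time \<open>2 n\<close>.\<close>
  define m where "m = ln (2 / L)"
  define D where "D = sqrt (4 * (K * 2 powr \<gamma> + \<bar>m\<bar>))"
  have "0 < K * 2 powr \<gamma> + \<bar>m\<bar>" using LK by (simp add: add_pos_nonneg)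
  then have D: "D > 0" "D\<^sup>2 = 4 * (K * 2 powr \<gamma> + \<bar>m\<bar>)" by (simp_all add: D_def)
  have half: "p (2 * n) (inv g) \<le> b n / 2"
    if g: "g \<in> carrier G" and n: "n > 0" "D * n powr ((1 + \<gamma>) / 2) \<le> len g" for g n
  proof -
    have "(D * n powr ((1 + \<gamma>) / 2))\<^sup>2 \<le> (len g)\<^sup>2"
      using n D by (intro power_mono) auto
    then have "D\<^sup>2 * n powr (1 + \<gamma>) / (4 * n) \<le> (len g)\<^sup>2 / (4 * n)"
      by (intro divide_right_mono)
        (simp_all add: power_mult_distrib power2_eq_square[of "_ powr _"] flip: powr_add)
    moreover have "D\<^sup>2 * n powr (1 + \<gamma>) / (4 * n) = (K * 2 powr \<gamma> + \<bar>m\<bar>) * n powr \<gamma>"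
      using n by (simp add: D(2) powr_add)
    ultimately have "K * (2 * n) powr \<gamma> + m \<le> (len g)\<^sup>2 / (4 * n)"
      using K_powr[OF n(1), of m] by linarith
    have "p (2 * n) (inv g) \<le> exp (- (len g)\<^sup>2 / (4 * n))"
      using Varopoulos_Carne[of "inv g" n] g n by simp
    also have "\<dots> \<le> exp (- (K * (2 * n) powr \<gamma> + m))"
      using \<open>K * (2 * n) powr \<gamma> + m \<le> (len g)\<^sup>2 / (4 * n)\<close> by simp
    also have "\<dots> = L * exp (- K * (2 * n) powr \<gamma>) / 2"
      using LK by (simp add: m_def exp_diff exp_minus exp_add field_simps)
    also have "\<dots> \<le> b n / 2" using b_lower[OF n(1)] by simp
    finally show ?thesis .
  qed

  have lower: "(len (inv y \<otimes> x) / D) powr c \<le> sqrt (\<Sum>\<^sub>\<infinity>i. (\<phi> (act x i) - \<phi> (act y i))\<^sup>2)"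
    if xy: "x \<in> carrier G" "y \<in> carrier G" for x y
  proof (cases "x = y")
    case True
    then show ?thesis using xy by simp
  next
    case False
    define g where "g = inv y \<otimes> x"
    have g: "g \<in> carrier G" and inv_g: "inv x \<otimes> y = inv g"
      using xy by (simp_all add: g_def inv_mult_group)
    have "g \<noteq> \<one>"
      using False xy by (metis g_def inv_equality inv_closed inv_inv)
    then have inv_g_one: "inv g \<noteq> \<one>" using g by (metis inv_inv inv_one)
    define M where "M = (len g / D) powr (2 / (1 + \<gamma>))"
    define N where "N = nat \<lfloor>M\<rfloor>"
    have "0 \<le> M" by (simp add: M_def)
    then have M: "0 \<le> M" "M < N + 1" unfolding N_def by linarith+
    \<comment> \<open>The density at time \<open>0\<close> is a point mass, moved by every \<open>g \<noteq> \<one>\<close>; it takes care of short \<open>g\<close>.\<close>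
    have close: "p (2 * n) (inv g) \<le> b n / 2" if "n \<le> N" for n
    proof (cases "n = 0")
      case True
      then show ?thesis using inv_g_one by (simp add: b0)
    next
      case False
      have "real n \<le> M" using that M unfolding N_def by linarith
      then have "n powr ((1 + \<gamma>) / 2) \<le> M powr ((1 + \<gamma>) / 2)"
        using \<gamma> by (intro powr_mono2) auto
      also have "\<dots> = len g / D"
      proof -
        have "2 / (1 + \<gamma>) * ((1 + \<gamma>) / 2) = 1" using \<gamma> by simp
        then have "M powr ((1 + \<gamma>) / 2) = (len g / D) powr 1"
          unfolding M_def powr_powr by (rule arg_cong)
        then show ?thesis using D by simp
      qed
      finally have "D * n powr ((1 + \<gamma>) / 2) \<le> len g" using D by (simp add: field_simps)
      then show ?thesis using False by (intro half g) auto
    qed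
    have summ: "q x y summable_on UNIV"
      using ell2_diff[OF virtual_coboundary_ell2[of S act \<phi> x, OF S act_one act_mult gen' xy(1)]
        virtual_coboundary_ell2[of S act \<phi> y, OF S act_one act_mult gen' xy(2)]]
      by (simp add: ell2_iff q_def)
    have "((len g / D) powr c)\<^sup>2 = M powr \<theta>"
    proof -
      have "2 / (1 + \<gamma>) * \<theta> = c + c" using \<gamma> by (simp add: \<theta>_def)
      then have "M powr \<theta> = (len g / D) powr (c + c)"
        unfolding M_def powr_powr by (rule arg_cong)
      then show ?thesis by (simp only: power2_eq_square powr_add)
    qed
    also have "\<dots> \<le> (N + 1) powr \<theta>"
      using M \<theta> by (intro powr_mono2) auto
    also have "\<dots> = (\<Sum>n\<le>N. (N + 1) powr (\<theta> - 1))"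
      by (simp add: powr_diff)
    also have "\<dots> \<le> (\<Sum>n\<le>N. a n * (2 * (b n - p (2 * n) (inv g))))"
    proof (rule sum_mono)
      fix n assume "n \<in> {..N}"
      then have n: "n \<le> N" by simp
      have "(N + 1) powr (\<theta> - 1) \<le> (n + 1) powr (\<theta> - 1)"
        using n \<theta> \<gamma> by (intro powr_mono2') auto
      also have "\<dots> = a n * b n" using b_pos[of n] by (simp add: a_def)
      also have "\<dots> \<le> a n * (2 * (b n - p (2 * n) (inv g)))"
        using close[OF n] a_nonneg by (intro mult_left_mono) auto
      finally show "(N + 1) powr (\<theta> - 1) \<le> a n * (2 * (b n - p (2 * n) (inv g)))" .
    qed
    also have "\<dots> = (\<Sum>\<^sub>\<infinity>n\<in>{..N}. gsum (\<lambda>z. q x y (n, z)))"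
      using xy by (simp add: fibre inv_g)
    also have "\<dots> = infsum (q x y) ({..N} \<times> carrier G)"
      using summable_on_subset_banach[OF summ, of "{..N} \<times> carrier G"]
      by (subst infsum_Sigma_banach) auto
    also have "\<dots> \<le> infsum (q x y) UNIV"
      using summable_on_subset_banach[OF summ, of "{..N} \<times> carrier G"] summ
      by (intro infsum_mono2) (auto simp: q_def)
    finally show ?thesis
      by (simp add: g_def q_def real_le_rsqrt)
  qed
  have "(1 - \<gamma>) / (1 + \<gamma>) \<le> 1" using \<gamma> by simp
  then have "c \<le> 1" using c by linarith
  then show ?thesis
    using compression_exponent_coboundary[of S act \<phi> D c, OF S act_one act_mult gen' D(1) c(1) _ lower]
    by simp
qed

lemma equivariant_compression_exponent_nonneg: "0 \<le> equivariant_compression_exponent G S"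
  unfolding equivariant_compression_exponent_def
  by (rule cSup_upper) (auto intro!: bdd_aboveI[of _ 1] simp: compression_exponent_le_1)

text \<open>
  The word length vanishes on the trivial group, so the zero cocycle has any compression.
\<close>

lemma (in group) compression_exponent_trivial_group:
  assumes S: "finite_symmetric_generating_set G S" and "carrier G = {\<one>}"
  shows "1 \<le> equivariant_compression_exponent G S"
  using assms
  by (intro compression_exponent_coboundary[where act = "\<lambda>_ i. i" and \<phi> = "\<lambda>_::unit. 0" and D = 1]) auto

theorem theorem1p1:
  fixes G :: "('g, 'm) monoid_scheme" and S :: "'g set" and L K \<gamma> :: real
  assumes "group G"
    and "finite_symmetric_generating_set G S"
    and "L > 0" and "K > 0" and "\<gamma> \<ge> 0"
    and "\<And>n::nat. n \<ge> 1 \<Longrightarrow>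
           convolution_power G (lazy_step G S) n \<one>\<^bsub>G\<^esub> \<ge> L * exp (- K * real n powr \<gamma>)"
  shows "equivariant_compression_exponent G S \<ge> (1 - \<gamma>) / (1 + \<gamma>)"
proof -
  interpret group G by (rule assms(1))
  \<comment> \<open>For empty \<open>S\<close> the weights of \<open>lazy_step\<close> do not add up to \<open>1\<close>, but the group is trivial.\<close>
  consider "\<gamma> \<ge> 1" | "S = {}" | "\<gamma> < 1" "S \<noteq> {}" by linarith
  then show ?thesis
  proof cases
    case 1
    then have "(1 - \<gamma>) / (1 + \<gamma>) \<le> 0" by (simp add: divide_nonpos_pos)
    then show ?thesis using equivariant_compression_exponent_nonneg[of G S] by linarith
  next
    case 2
    then have "carrier G = {\<one>\<^bsub>G\<^esub>}"
      using assms(2) generate_empty by (simp add: finite_symmetric_generating_set_def)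
    then have "1 \<le> equivariant_compression_exponent G S"
      by (rule compression_exponent_trivial_group[OF assms(2)])
    moreover have "(1 - \<gamma>) / (1 + \<gamma>) \<le> 1" using \<open>\<gamma> \<ge> 0\<close> by simp
    ultimately show ?thesis by linarith
  next
    case 3
    then interpret lazy_walk G S by unfold_locales (use assms(2) in auto)
    show ?thesis
    proof (rule dense_le_bounded)
      show "0 < (1 - \<gamma>) / (1 + \<gamma>)" using 3 \<open>\<gamma> \<ge> 0\<close> by simp
      show "c \<le> equivariant_compression_exponent G S" if "0 < c" "c < (1 - \<gamma>) / (1 + \<gamma>)" for c
        using assms(3-6) 3 that by (intro compression_exponent_lower_bound[of L K \<gamma> c]) auto
    qed
  qed
qed

end
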